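(* Let $\gamma\in C^{0,1}(\mathbb T^1;\mathbb R^3)$ be a closed curve with finite distortion and constant speed, $|\gamma'(x)|\equiv\mathrm{len}(\gamma)/2\pi$. Then $$c_p(\gamma)\le C_p\left(\frac{2\pi}{\mathrm{len}(\gamma)}\right)^2\|\gamma\|^2_{\dot H^{\frac{3+p}2}(\mathbb T^1)}\,\delta_\infty^3(\gamma),$$ where $$C_p:=2\sqrt2\,(2\pi)^{p+1}\left(\int_0^\infty\frac{1-\cos u}{u^{2+p}}\,du\right)^{\frac12}\left(\int_0^\infty\frac{(1-\cos u)^2+(\sin u-u)^2}{u^{4+p}}\,du\right)^{\frac12},$$ and if $-1<p<1$ then the constant $C_p$ is finite.
   Context: $\mathbb T^1$ is $[-\pi,\pi]$ with endpoints identified; $\vartheta(z)=\min\{|z|,2\pi-|z|\}$ on $[-\pi,\pi]$, extended $2\pi$-periodically. $\mathrm{len}(\gamma)=\int_{\mathbb T^1}|\gamma'|dx$. With $\hat\gamma_k=\frac1{2\pi}\int_{\mathbb T^1}\gamma(x)e^{-ikx}dx$, $\|\gamma\|_{\dot H^s}^2=\sum_{k\in\mathbb Z}|k|^{2s}|\hat\gamma_k|^2$ (possibly $+\infty$). The distortion $\delta_\infty(\gamma)$ is the supremum, over distinct points of the curve, of the ratio of arc-length distance along the curve to Euclidean distance; for constant speed $\gamma$, $\delta_\infty(\gamma)=\frac{\mathrm{len}(\gamma)}{2\pi}\sup_{\vartheta(x-y)>0}\frac{\vartheta(x-y)}{|\gamma(x)-\gamma(y)|}$. The weighted quantity $c_p(\gamma)$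 is $$c_p(\gamma)=\int_{\mathbb T^1\times\mathbb T^1}\left(\frac{\mathrm{len}(\gamma)}{D_\gamma(\gamma(x),\gamma(x+z))}\right)^p\frac{|\langle\gamma'(x),\gamma'(x+z),\gamma(x+z)-\gamma(x)\rangle|}{|\gamma(x+z)-\gamma(x)|^3}\,dz\,dx,$$ where $\langle a,b,c\rangle=\langle a,b\times c\rangle$ is the scalar triple product and $D_\gamma$ is the arc-length distance along $\gamma$ (so $D_\gamma(\gamma(x),\gamma(x+z))=\frac{\mathrm{len}(\gamma)}{2\pi}\vartheta(z)$ for constant speed curves). *)

theory Defs
  imports "HOL-Analysis.Analysis"
begin

text \<open>
  A closed curve on the circle of length \<open>2\<pi>\<close> is a \<open>2\<pi>\<close>-periodic map on the real line.  All
  integrals over the circle are integrals over \<open>[-\<pi>, \<pi>]\<close>.  Quantities which may be infinite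
  take values in \<^typ>\<open>ennreal\<close>.
\<close>

definition closed_lipschitz_curve :: "(real \<Rightarrow> real ^ 3) \<Rightarrow> bool" where
  "closed_lipschitz_curve \<gamma> \<longleftrightarrow>
     (\<forall>x. \<gamma> (x + 2 * pi) = \<gamma> x) \<and> (\<exists>L. L-lipschitz_on UNIV \<gamma>)"

abbreviation curve_deriv :: "(real \<Rightarrow> real ^ 3) \<Rightarrow> real \<Rightarrow> real ^ 3" where
  "curve_deriv \<gamma> x \<equiv> vector_derivative \<gamma> (at x)"

definition len :: "(real \<Rightarrow> real ^ 3) \<Rightarrow> real" where
  "len \<gamma> = (LINT x:{-pi..pi}|lebesgue. norm (curve_deriv \<gamma> x))"

text \<open>
  A Lipschitz curve is differentiable almost everywhere only, so its speed is constant almost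
  everywhere.  As \<^const>\<open>vector_derivative\<close> is an arbitrary vector at points where there is no
  derivative, differentiability is part of the condition.
\<close>

definition constant_speed :: "(real \<Rightarrow> real ^ 3) \<Rightarrow> bool" where
  "constant_speed \<gamma> \<longleftrightarrow>
     (AE x in lebesgue. \<gamma> differentiable (at x) \<and> norm (curve_deriv \<gamma> x) = len \<gamma> / (2 * pi))"

text \<open>
  The arc-length distance along the curve between the points with parameters \<open>x\<close> and \<open>y\<close>: the
  length of the shorter of the two arcs joining them.  The arc which leaves \<open>x\<close> in the positive
  direction has the parameter interval \<open>[x, x + a]\<close> where \<open>a \<in> [0, 2\<pi>)\<close> and
  \<open>a \<equiv> y - x\<close> modulo \<open>2\<pi>\<close>.
\<close>

definition arc_dist :: "(real \<Rightarrow> real ^ 3) \<Rightarrow> real \<Rightarrow> real \<Rightarrow> real" where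
  "arc_dist \<gamma> x y =
     (let l = (LINT t:{x..x + 2 * pi * frac ((y - x) / (2 * pi))}|lebesgue. norm (curve_deriv \<gamma> t))
      in min l (len \<gamma> - l))"

text \<open>
  Distinct points of the curve are points with distinct parameters in the circle.  In particular
  a self-intersection makes the distortion infinite, since \<open>r / 0 = \<infinity>\<close> for \<open>r > 0\<close> in
  \<^typ>\<open>ennreal\<close>.
\<close>

definition distortion :: "(real \<Rightarrow> real ^ 3) \<Rightarrow> ennreal" where
  "distortion \<gamma> =
     (SUP (x, y) \<in> {(x, y). x \<in> {-pi..<pi} \<and> y \<in> {-pi..<pi} \<and> x \<noteq> y}.
        ennreal (arc_dist \<gamma> x y) / ennreal (norm (\<gamma> x - \<gamma> y)))"

definition fourier_coeff :: "(real \<Rightarrow> real ^ 3) \<Rightarrow> int \<Rightarrow> complex ^ 3" where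
  "fourier_coeff \<gamma> k =
     (\<chi> j. 1 / (2 * pi) *
        (LINT x:{-pi..pi}|lebesgue. complex_of_real (\<gamma> x $ j) * exp (- \<i> * of_int k * of_real x)))"

text \<open>
  The square of the homogeneous Sobolev seminorm of order \<open>s\<close>.  The mean does not contribute for
  any \<open>s\<close>, because \<open>0 powr a = 0\<close> for every \<open>a\<close>.
\<close>

definition Hdot_norm_sq :: "real \<Rightarrow> (real \<Rightarrow> real ^ 3) \<Rightarrow> ennreal" where
  "Hdot_norm_sq s \<gamma> =
     (\<Sum>\<^sub>\<infinity>k\<in>(UNIV :: int set).
        ennreal (\<bar>real_of_int k\<bar> powr (2 * s) * (norm (fourier_coeff \<gamma> k))\<^sup>2))"

definition triple :: "real ^ 3 \<Rightarrow> real ^ 3 \<Rightarrow> real ^ 3 \<Rightarrow> real" where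
  "triple a b c = a \<bullet> cross3 b c"

definition weighted_acn :: "real \<Rightarrow> (real \<Rightarrow> real ^ 3) \<Rightarrow> ennreal" where
  "weighted_acn p \<gamma> =
     (\<integral>\<^sup>+(x, z) \<in> {-pi..pi} \<times> {-pi..pi}.
        ennreal ((len \<gamma> / arc_dist \<gamma> x (x + z)) powr p *
          (\<bar>triple (curve_deriv \<gamma> x) (curve_deriv \<gamma> (x + z)) (\<gamma> (x + z) - \<gamma> x)\<bar> /
           norm (\<gamma> (x + z) - \<gamma> x) ^ 3))
      \<partial>lebesgue)"

definition ennreal_sqrt :: "ennreal \<Rightarrow> ennreal" where
  "ennreal_sqrt x = (if x = \<infinity> then \<infinity> else ennreal (sqrt (enn2real x)))"

definition C_const :: "real \<Rightarrow> ennreal" where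
  "C_const p =
     ennreal (2 * sqrt 2 * (2 * pi) powr (p + 1)) *
     ennreal_sqrt (\<integral>\<^sup>+u\<in>{0<..}. ennreal ((1 - cos u) / u powr (2 + p)) \<partial>lebesgue) *
     ennreal_sqrt (\<integral>\<^sup>+u\<in>{0<..}. ennreal (((1 - cos u)\<^sup>2 + (sin u - u)\<^sup>2) / u powr (4 + p)) \<partial>lebesgue)"

end

theory Submission
  imports Defs
begin

text \<open>
  Write \<open>v = len \<gamma> / 2\<pi>\<close> for the speed.  Subtracting multiples of \<open>\<gamma>'(x)\<close> from the last two
  factors does not change the triple product of \<open>\<gamma>'(x)\<close>, \<open>\<gamma>'(x+z)\<close> and \<open>\<gamma>(x+z) - \<gamma>(x)\<close>, so
  it is at most \<open>v |\<gamma>'(x+z) - \<gamma>'(x)| |\<gamma>(x+z) - \<gamma>(x) - z \<gamma>'(x)|\<close> in absolute value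
  (\<open>triple_le\<close>).
  Finite distortion means \<open>v |z| \<le> \<delta>\<^sub>\<infinity>(\<gamma>) |\<gamma>(x+z) - \<gamma>(x)|\<close> for \<open>|z| \<le> \<pi>\<close>, which replaces
  the denominator by a power of \<open>|z|\<close> (\<open>weighted_integrand_le\<close>).  The total weight \<open>|z|\<^sup>-\<^sup>3\<^sup>-\<^sup>p\<close> is
  split as the product of the square roots of \<open>|z|\<^sup>-\<^sup>2\<^sup>-\<^sup>p\<close> and \<open>|z|\<^sup>-\<^sup>4\<^sup>-\<^sup>p\<close>, and the Cauchy-Schwarz
  inequality separates the two differences (\<open>Cauchy_Schwarz_weighted_energies\<close>).

  On the Fourier side, the squared \<open>L\<^sup>2\<close> norms in \<open>x\<close> of the two differences have the multipliers
  \<open>k\<^sup>2 \<cdot> 2 (1 - cos kz)\<close> and \<open>(1 - cos kz)\<^sup>2 + (sin kz - kz)\<^sup>2\<close>.  After the substitution \<open>u = kz\<close> the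
  integral over \<open>z\<close> gives in both cases \<open>|k|\<^sup>3\<^sup>+\<^sup>p\<close> times one of the two integrals in \<open>C\<^sub>p\<close>
  (\<open>nn_integral_Fourier_weight\<close>), hence a multiple of the Sobolev norm
  (\<open>weighted_velocity_energy_le\<close>, \<open>weighted_Taylor_energy_le\<close>).

  The norms are bounded by their Fourier series through \<open>\<integral>|g|\<^sup>2 \<le> 2\<pi> \<Sum>|g\<^sub>k|\<^sup>2\<close>, where \<open>g\<close> contains
  \<open>\<gamma>'\<close> and is merely bounded and measurable.  For Lipschitz \<open>g\<close> the Fourier series converges at every point
  (\<open>Fourier_series_Lipschitz\<close>), so that Fatou's lemma gives the inequality
  (\<open>Parseval_Lipschitz\<close>).  A second use of Fatou's lemma, for difference quotients, extends it to
  almost everywhere derivatives of Lipschitz functions (\<open>Parseval_derivative\<close>).  Both differences above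
  are of this kind: the first is the derivative of \<open>\<gamma>(x+z) - \<gamma>(x)\<close>, the second that of
  \<open>(\<integral> over [x, x+z] of \<gamma>) - z \<gamma>(x)\<close>.

  All sums and integrals are taken in the extended nonnegative reals, so infinite Sobolev norms
  and infinite constants are covered by the same computation.
\<close>

section \<open>Integration over one period\<close>

definition circle :: "real measure" where
  "circle = restrict_space lborel {-pi..pi}"

lemma space_circle [simp]: "space circle = {-pi..pi}"
  by (simp add: circle_def)

lemma finite_measure_circle: "finite_measure circle"
  by (rule finite_measureI) (simp add: circle_def emeasure_restrict_space)

interpretation circle: finite_measure circle
  by (rule finite_measure_circle)

lemma measurable_circle [measurable_dest]:
  "f \<in> borel_measurable borel \<Longrightarrow> f \<in> borel_measurable circle"
  unfolding circle_def by (rule measurable_restrict_space1) simp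

lemma nn_integral_circle:
  "(\<integral>\<^sup>+x. f x \<partial>circle) = (\<integral>\<^sup>+x. f x * indicator {-pi..pi} x \<partial>lborel)"
  unfolding circle_def by (subst nn_integral_restrict_space) auto

lemma integral_circle:
  fixes f :: "real \<Rightarrow> 'a :: {banach, second_countable_topology}"
  shows "(\<integral>x. f x \<partial>circle) = (\<integral>x. indicator {-pi..pi} x *\<^sub>R f x \<partial>lborel)"
  unfolding circle_def by (subst integral_restrict_space) auto

lemma AE_circle: "(AE x in circle. P x) \<longleftrightarrow> (AE x in lborel. x \<in> {-pi..pi} \<longrightarrow> P x)"
  unfolding circle_def by (subst AE_restrict_space_iff) auto

lemma integrable_circle_bounded:
  fixes f :: "real \<Rightarrow> 'a :: {banach, second_countable_topology}"
  assumes "f \<in> borel_measurable borel" "\<And>x. x \<in> {-pi..pi} \<Longrightarrow> norm (f x) \<le> B"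
  shows "integrable circle f"
  using assms by (intro circle.integrable_const_bound[of _ B] measurable_circle AE_I2) auto

lemma integrable_circle_continuous:
  fixes f :: "real \<Rightarrow> 'a :: {banach, second_countable_topology}"
  assumes "continuous_on UNIV f"
  shows "integrable circle f"
proof -
  have "bounded (f ` {-pi..pi})"
    using assms continuous_on_subset compact_continuous_image compact_imp_bounded
    by (metis compact_Icc top_greatest)
  then obtain B where "\<forall>y\<in>f ` {-pi..pi}. norm y \<le> B"
    unfolding bounded_iff by blast
  then have "\<And>x. x \<in> {-pi..pi} \<Longrightarrow> norm (f x) \<le> B"
    by blast
  then show ?thesis
    using assms by (intro integrable_circle_bounded borel_measurable_continuous_onI)
qed

lemma integral_circle_FTC:
  fixes F :: "real \<Rightarrow> 'a :: euclidean_space"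
  assumes "\<And>x. (F has_vector_derivative f x) (at x)" "continuous_on UNIV f"
  shows "(\<integral>x. f x \<partial>circle) = F pi - F (-pi)"
  unfolding integral_circle
  by (rule integral_FTC_Icc)
     (auto intro: has_vector_derivative_at_within assms continuous_on_subset[OF assms(2)])

lemma has_vector_derivative_shift:
  assumes "(F has_vector_derivative f) (at (x + a))"
  shows "((\<lambda>x. F (x + a)) has_vector_derivative f) (at x)"
proof -
  have "((\<lambda>x. x + a) has_vector_derivative 1) (at x)"
    by (auto intro!: derivative_eq_intros)
  from vector_diff_chain_at[OF this assms] show ?thesis
    by (simp add: o_def)
qed

text \<open>
  The increment of an antiderivative over a period has derivative zero.  The antiderivative itself is
  periodic only when the mean vanishes.
\<close>
lemma periodic_antiderivative:
  fixes f :: "real \<Rightarrow> complex"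
  assumes per: "\<And>x. f (x + 2 * pi) = f x" and cont: "continuous_on UNIV f"
  obtains F c where "\<And>x. (F has_vector_derivative f x) (at x)" "\<And>x. F (x + 2 * pi) - F x = c"
proof -
  have "\<exists>F. \<forall>x :: real. -\<infinity> < ereal x \<longrightarrow> ereal x < \<infinity> \<longrightarrow> (F has_vector_derivative f x) (at x)"
    using cont by (intro einterval_antiderivative) (auto simp: continuous_on_eq_continuous_at)
  then obtain F where F: "\<And>x. (F has_vector_derivative f x) (at x)"
    by auto
  have "((\<lambda>x. F (x + 2 * pi) - F x) has_vector_derivative 0) (at x)" for x
    using has_vector_derivative_diff[OF has_vector_derivative_shift[OF F[of "x + 2 * pi"]] F[of x]] per by simp
  then obtain c where c: "\<And>x. F (x + 2 * pi) - F x = c"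
    using has_vector_derivative_zero_constant[of UNIV "\<lambda>x. F (x + 2 * pi) - F x"] by auto
  with F show ?thesis by (rule that)
qed

lemma integral_circle_shift:
  fixes f :: "real \<Rightarrow> complex"
  assumes per: "\<And>x. f (x + 2 * pi) = f x" and cont: "continuous_on UNIV f"
  shows "(\<integral>x. f (x + z) \<partial>circle) = (\<integral>x. f x \<partial>circle)"
proof -
  obtain F c where F: "\<And>x. (F has_vector_derivative f x) (at x)"
      and c: "\<And>x. F (x + 2 * pi) - F x = c"
    using periodic_antiderivative[of f] per cont by blast
  have Fs: "((\<lambda>x. F (x + a)) has_vector_derivative f (x + a)) (at x)" for x a
    by (rule has_vector_derivative_shift[OF F])
  have "(\<integral>x. f (x + z) \<partial>circle) = F (pi + z) - F (-pi + z)"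
    by (rule integral_circle_FTC[OF Fs]) (intro continuous_intros continuous_on_compose2[OF cont], auto)
  also have "\<dots> = F (-pi + 2 * pi) - F (-pi)"
    using c[of "-pi + z"] c[of "-pi"] by (simp add: algebra_simps)
  also have "\<dots> = (\<integral>x. f x \<partial>circle)"
    by (subst integral_circle_FTC[OF F cont]) simp
  finally show ?thesis .
qed

section \<open>Fourier series of Lipschitz functions\<close>

definition fcoef :: "(real \<Rightarrow> complex) \<Rightarrow> int \<Rightarrow> complex" where
  "fcoef f k = (\<integral>x. f x * cis (- (of_int k * x)) \<partial>circle) / (2 * pi)"

lemma has_vector_derivative_cis [derivative_intros]:
  "((\<lambda>x. cis (a * x)) has_vector_derivative (\<i> * a * cis (a * x))) (at x within S)"
  unfolding cis_conv_exp
  by (auto intro!: derivative_eq_intros has_vector_derivative_real_field)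

lemma integral_circle_cis:
  "(\<integral>x. cis (of_int k * x) \<partial>circle) = (if k = 0 then 2 * pi else 0)"
proof (cases "k = 0")
  case True
  then show ?thesis
    by (simp add: circle_def measure_restrict_space scaleR_conv_of_real)
next
  case False
  have *: "((\<lambda>x. cis (of_int k * x) / (\<i> * of_int k)) has_vector_derivative cis (of_int k * x)) (at x)" for x
    using has_vector_derivative_divide[OF has_vector_derivative_cis[of "of_int k" x UNIV], of "\<i> * of_int k"] False
    by simp
  have "cis (of_int k * pi) = cis (of_int k * (-pi))"
  proof -
    have "cis (of_int k * (-pi)) * cis (2 * pi * of_int k) = cis (of_int k * (- pi) + 2 * pi * of_int k)"
      by (rule cis_mult)
    moreover have "cis (2 * pi * of_int k) = 1" by simp
    ultimately show ?thesis by (simp add: algebra_simps del: cis_multiple_2pi)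
  qed
  then show ?thesis
    using False by (subst integral_circle_FTC[OF *]) (auto intro!: continuous_intros)
qed

text \<open>
  The expansion of the square, by orthogonality of the characters.  With \<open>a\<close> the Fourier
  coefficients of \<open>f\<close> it yields the inequality of Bessel, with \<open>f = 0\<close> the norm of a trigonometric
  polynomial.
\<close>
lemma integral_circle_trig_distance:
  fixes f :: "real \<Rightarrow> complex" and a :: "int \<Rightarrow> complex"
  assumes [measurable]: "f \<in> borel_measurable borel"
    and bnd: "\<And>x. x \<in> {-pi..pi} \<Longrightarrow> cmod (f x) \<le> B" and "finite A"
  shows "(\<integral>x. (cmod (f x - (\<Sum>k\<in>A. a k * cis (of_int k * x))))\<^sup>2 \<partial>circle) =
           (\<integral>x. (cmod (f x))\<^sup>2 \<partial>circle) - 4 * pi * (\<Sum>k\<in>A. Re (fcoef f k * cnj (a k)))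
           + 2 * pi * (\<Sum>k\<in>A. (cmod (a k))\<^sup>2)"
proof -
  let ?e = "\<lambda>k x. cis (real_of_int k * x)"
  have B0: "0 \<le> B"
    using order_trans[OF norm_ge_zero bnd[of 0]] by simp
  have m [measurable]: "?e k \<in> borel_measurable borel" for k
    by (intro borel_measurable_continuous_onI continuous_intros)
  have ff: "integrable circle (\<lambda>x. f x * cnj (f x))"
  proof (rule integrable_circle_bounded[where B = "B * B"])
    have "cnj \<in> borel_measurable borel"
      by (intro borel_measurable_continuous_onI continuous_intros)
    then show "(\<lambda>x. f x * cnj (f x)) \<in> borel_measurable borel"
      by measurable
  qed (use bnd B0 in \<open>auto simp: norm_mult intro!: mult_mono\<close>)
  have fe: "integrable circle (\<lambda>x. f x * cis (- (real_of_int k * x)))" for k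
  proof (rule integrable_circle_bounded[where B = B])
    show "(\<lambda>x. f x * cis (- (real_of_int k * x))) \<in> borel_measurable borel"
      using m[of "-k"] by (intro borel_measurable_times) auto
  qed (auto simp: norm_mult bnd)
  have ee: "integrable circle (?e k)" for k
    by (intro integrable_circle_continuous continuous_intros)
  have expand: "complex_of_real ((cmod (f x - (\<Sum>k\<in>A. a k * ?e k x)))\<^sup>2) =
      f x * cnj (f x) - (\<Sum>k\<in>A. cnj (a k) * (f x * cis (- (real_of_int k * x))))
      - (\<Sum>k\<in>A. a k * cnj (f x * cis (- (real_of_int k * x))))
      + (\<Sum>k\<in>A. \<Sum>l\<in>A. a k * cnj (a l) * ?e (k - l) x)" for x
  proof -
    have c: "cnj (?e k x) = cis (- (real_of_int k * x))" for k
      by (auto simp: cis_cnj)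
    have d: "?e (k - l) x = ?e k x * cnj (?e l x)" for k l
      by (simp add: cis_cnj cis_mult algebra_simps)
    have "complex_of_real ((cmod (f x - (\<Sum>k\<in>A. a k * ?e k x)))\<^sup>2) =
      (f x - (\<Sum>k\<in>A. a k * ?e k x)) * (cnj (f x) - (\<Sum>k\<in>A. cnj (a k) * cnj (?e k x)))"
      by (simp only: complex_norm_square complex_cnj_diff cnj_sum complex_cnj_mult)
    also have "\<dots> = f x * cnj (f x) - (\<Sum>k\<in>A. cnj (a k) * (f x * cnj (?e k x)))
      - (\<Sum>k\<in>A. a k * (cnj (f x) * ?e k x))
      + (\<Sum>k\<in>A. \<Sum>l\<in>A. a k * cnj (a l) * (?e k x * cnj (?e l x)))"
    proof -
      have prod_diff: "(u - v) * (u' - v') = u * u' - u * v' - v * u' + v * v'" for u v u' v' :: complex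
        by (simp add: algebra_simps)
      show ?thesis
        unfolding prod_diff sum_product unfolding sum_distrib_left sum_distrib_right by (simp add: mult_ac)
    qed
    finally show ?thesis
      by (simp only: d c[symmetric] complex_cnj_mult complex_cnj_cnj)
  qed
  have "complex_of_real (\<integral>x. (cmod (f x - (\<Sum>k\<in>A. a k * ?e k x)))\<^sup>2 \<partial>circle) =
      (\<integral>x. complex_of_real ((cmod (f x - (\<Sum>k\<in>A. a k * ?e k x)))\<^sup>2) \<partial>circle)"
    by (rule integral_complex_of_real[symmetric])
  also have "\<dots> = (\<integral>x. f x * cnj (f x) \<partial>circle)
      - (\<Sum>k\<in>A. cnj (a k) * (\<integral>x. f x * cis (- (real_of_int k * x)) \<partial>circle))
      - (\<Sum>k\<in>A. a k * cnj (\<integral>x. f x * cis (- (real_of_int k * x)) \<partial>circle))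
      + (\<Sum>k\<in>A. \<Sum>l\<in>A. a k * cnj (a l) * (\<integral>x. ?e (k - l) x \<partial>circle))"
    unfolding expand
    by (intro has_bochner_integral_integral_eq has_bochner_integral_add has_bochner_integral_diff
        has_bochner_integral_sum has_bochner_integral_mult_right
        has_bochner_integral_bounded_linear[OF bounded_linear_cnj]
        has_bochner_integral_integrable ff fe ee)
  also have "(\<integral>x. f x * cnj (f x) \<partial>circle) = of_real (\<integral>x. (cmod (f x))\<^sup>2 \<partial>circle)"
    by (simp only: complex_norm_square[symmetric] integral_complex_of_real of_real_power[symmetric])
  also have "(\<Sum>k\<in>A. \<Sum>l\<in>A. a k * cnj (a l) * (\<integral>x. ?e (k - l) x \<partial>circle)) =
      of_real (2 * pi * (\<Sum>k\<in>A. (cmod (a k))\<^sup>2))"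
  proof -
    have "(\<Sum>l\<in>A. a k * cnj (a l) * (\<integral>x. ?e (k - l) x \<partial>circle)) = 2 * pi * (a k * cnj (a k))"
      if "k \<in> A" for k
    proof -
      have "(\<Sum>l\<in>A. a k * cnj (a l) * (\<integral>x. ?e (k - l) x \<partial>circle)) =
        (\<Sum>l\<in>A. if l = k then 2 * pi * (a k * cnj (a k)) else 0)"
        by (intro sum.cong refl) (subst integral_circle_cis, auto)
      then show ?thesis using that \<open>finite A\<close> by simp
    qed
    then show ?thesis
      by (simp add: complex_norm_square[symmetric] sum_distrib_left del: of_real_power)
  qed
  finally have *: "complex_of_real (\<integral>x. (cmod (f x - (\<Sum>k\<in>A. a k * ?e k x)))\<^sup>2 \<partial>circle) =
      of_real (\<integral>x. (cmod (f x))\<^sup>2 \<partial>circle)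
      - (\<Sum>k\<in>A. cnj (a k) * (\<integral>x. f x * cis (- (real_of_int k * x)) \<partial>circle))
      - (\<Sum>k\<in>A. a k * cnj (\<integral>x. f x * cis (- (real_of_int k * x)) \<partial>circle))
      + of_real (2 * pi * (\<Sum>k\<in>A. (cmod (a k))\<^sup>2))" .
  have I: "(\<integral>x. f x * cis (- (real_of_int k * x)) \<partial>circle) = 2 * pi * fcoef f k" for k
    by (simp add: fcoef_def)
  have "Re (complex_of_real (\<integral>x. (cmod (f x - (\<Sum>k\<in>A. a k * ?e k x)))\<^sup>2 \<partial>circle)) =
     (\<integral>x. (cmod (f x))\<^sup>2 \<partial>circle) - 4 * pi * (\<Sum>k\<in>A. Re (fcoef f k * cnj (a k)))
           + 2 * pi * (\<Sum>k\<in>A. (cmod (a k))\<^sup>2)"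
  proof -
    have r: "Re (cnj (a k) * (2 * pi * fcoef f k)) = 2 * pi * Re (fcoef f k * cnj (a k))"
        "Re (a k * cnj (2 * pi * fcoef f k)) = 2 * pi * Re (fcoef f k * cnj (a k))" for k
      by (simp_all add: algebra_simps)
    show ?thesis
      unfolding * I minus_complex.sel plus_complex.sel Re_sum r Re_complex_of_real
      by (simp add: sum_distrib_left[symmetric])
  qed
  then show ?thesis by simp
qed

lemma Bessel_inequality:
  assumes [measurable]: "f \<in> borel_measurable borel"
    and bnd: "\<And>x. x \<in> {-pi..pi} \<Longrightarrow> cmod (f x) \<le> B" and "finite A"
  shows "(\<Sum>k\<in>A. (cmod (fcoef f k))\<^sup>2) \<le> B\<^sup>2"
proof -
  have "0 \<le> (\<integral>x. (cmod (f x - (\<Sum>k\<in>A. fcoef f k * cis (of_int k * x))))\<^sup>2 \<partial>circle)"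
    by simp
  also have "\<dots> = (\<integral>x. (cmod (f x))\<^sup>2 \<partial>circle) - 2 * pi * (\<Sum>k\<in>A. (cmod (fcoef f k))\<^sup>2)"
  proof -
    have "Re (fcoef f k * cnj (fcoef f k)) = (cmod (fcoef f k))\<^sup>2" for k
      by (simp only: complex_norm_square[symmetric] of_real_power[symmetric] Re_complex_of_real)
    then show ?thesis
      by (subst integral_circle_trig_distance[OF assms]) simp_all
  qed
  also have "(\<integral>x. (cmod (f x))\<^sup>2 \<partial>circle) \<le> (\<integral>x. B\<^sup>2 \<partial>circle)"
    using bnd by (intro integral_mono integrable_circle_bounded[where B = "B\<^sup>2"]) (auto intro!: power_mono)
  also have "\<dots> = 2 * pi * B\<^sup>2"
    by (simp add: circle_def measure_restrict_space)
  finally show ?thesis by simp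
qed

text \<open>
  By the inequality of Bessel the squared coefficients along distinct frequencies are summable.
\<close>
lemma Riemann_Lebesgue:
  assumes "f \<in> borel_measurable borel"
    and "\<And>x. x \<in> {-pi..pi} \<Longrightarrow> cmod (f x) \<le> B" and "inj \<kappa>"
  shows "(\<lambda>n::nat. fcoef f (\<kappa> n)) \<longlonglongrightarrow> 0"
proof -
  have "(\<Sum>i<n. (cmod (fcoef f (\<kappa> i)))\<^sup>2) \<le> B\<^sup>2" for n
  proof -
    have "(\<Sum>i<n. (cmod (fcoef f (\<kappa> i)))\<^sup>2) = (\<Sum>k\<in>\<kappa> ` {..<n}. (cmod (fcoef f k))\<^sup>2)"
      using assms(3) by (subst sum.reindex) (auto intro: inj_on_subset)
    also have "\<dots> \<le> B\<^sup>2"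
      by (rule Bessel_inequality[OF assms(1,2)]) auto
    finally show ?thesis .
  qed
  then have "summable (\<lambda>i. (cmod (fcoef f (\<kappa> i)))\<^sup>2)"
    by (intro summableI_nonneg_bounded) auto
  then have "(\<lambda>i. (cmod (fcoef f (\<kappa> i)))\<^sup>2) \<longlonglongrightarrow> 0"
    by (rule summable_LIMSEQ_zero)
  from tendsto_real_sqrt[OF this] show ?thesis
    by (simp add: tendsto_norm_zero_iff)
qed

lemma sin_cubic_bound:
  fixes t :: real
  assumes "0 \<le> t"
  shows "\<bar>sin t - t\<bar> \<le> t ^ 3 / 6"
proof -
  have "(\<Sum>m<3. sin_coeff m * t ^ m) = t"
    by (simp add: eval_nat_numeral sin_coeff_def)
  then show ?thesis
    using Maclaurin_sin_bound[of t 3] assms by (simp add: fact_numeral field_simps)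
qed

lemma cmod_cis_minus_one_sq: "(cmod (cis t - 1))\<^sup>2 = 2 * (1 - cos t)"
proof -
  have "(cmod (cis t - 1))\<^sup>2 = (cos t - 1)\<^sup>2 + (sin t)\<^sup>2"
    by (simp add: cmod_power2)
  then show ?thesis
    using sin_cos_squared_add[of t] by (simp add: power2_eq_square algebra_simps)
qed

text \<open>
  The chord of the unit circle is \<open>2 sin t\<close> for the half angle \<open>t \<le> \<pi>/2\<close>, and
  \<open>t - t\<^sup>3/6 \<ge> t/2\<close> on that range.  The constant is not sharp.
\<close>
lemma abs_le_norm_cis_minus_one:
  fixes x :: real
  assumes "\<bar>x\<bar> \<le> pi"
  shows "\<bar>x\<bar> \<le> 2 * cmod (cis x - 1)"
proof -
  define t where "t = \<bar>x\<bar> / 2"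
  have t: "0 \<le> t" "t \<le> 16/10" using assms pi_approx by (auto simp: t_def)
  have "t ^ 3 = t * (t * t)" by (simp add: power3_eq_cube)
  moreover have "t * (t * t) \<le> t * (16/10 * (16/10))"
    using t by (intro mult_mono) auto
  ultimately have s: "sin t \<ge> t / 2" using t sin_cubic_bound[OF t(1)] by linarith
  have "(cmod (cis x - 1))\<^sup>2 = 2 - 2 * cos (2 * t)"
    by (simp add: cmod_cis_minus_one_sq t_def)
  also have "\<dots> = (2 * sin t)\<^sup>2"
    using cos_double_sin[of t] by (simp add: power_mult_distrib)
  finally have "cmod (cis x - 1) = 2 * sin t \<or> cmod (cis x - 1) = - (2 * sin t)"
    by (simp only: power2_eq_iff)
  moreover have "\<bar>x\<bar> = 2 * t" by (simp add: t_def)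
  ultimately show ?thesis using s t norm_ge_zero[of "cis x - 1"] by linarith
qed

lemma fcoef_shift:
  assumes per: "\<And>x. f (x + 2 * pi) = f x" and cont: "continuous_on UNIV f"
  shows "fcoef (\<lambda>x. f (x + z)) k = cis (of_int k * z) * fcoef f k"
proof -
  let ?g = "\<lambda>x. f x * cis (- (of_int k * x))"
  have "?g (x + 2 * pi) = ?g x" for x
  proof -
    have "cis (- (of_int k * (x + 2 * pi))) = cis (- (of_int k * x)) * cis (2 * pi * of_int (- k))"
      by (subst cis_mult) (simp add: algebra_simps)
    then show ?thesis using per by (simp del: of_int_minus)
  qed
  then have "(\<integral>x. ?g (x + z) \<partial>circle) = (\<integral>x. ?g x \<partial>circle)"
    by (intro integral_circle_shift continuous_intros cont)
  moreover have "f (x + z) * cis (- (of_int k * x)) = cis (of_int k * z) * ?g (x + z)" for x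
  proof -
    have "cis (- (of_int k * x)) = cis (of_int k * z) * cis (- (of_int k * (x + z)))"
      by (subst cis_mult) (simp add: algebra_simps)
    then show ?thesis by (simp only:) (rule mult.left_commute)
  qed
  ultimately show ?thesis
    unfolding fcoef_def by (simp only: integral_mult_right_zero times_divide_eq_right)
qed

lemma sum_telescope_symmetric:
  fixes b :: "int \<Rightarrow> 'a :: ab_group_add"
  shows "(\<Sum>k\<in>{-int N..int N}. b (k - 1) - b k) = b (- int N - 1) - b (int N)"
proof (induction N)
  case (Suc N)
  have "{-int (Suc N)..int (Suc N)} = insert (- int N - 1) (insert (int N + 1) {-int N..int N})"
    by auto
  then show ?case using Suc by (simp add: add.commute)
qed auto

text \<open>
  The quotient \<open>h(x) = (g(x) - g(0)) / (e\<^sup>i\<^sup>x - 1)\<close> is bounded on a period since \<open>g\<close> is Lipschitz, and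
  \<open>g = g(0) + h e\<^sup>i\<^sup>x - h\<close> shows that the coefficients of \<open>g - g(0)\<close> are differences of consecutive
  coefficients of \<open>h\<close>.  The symmetric partial sums telescope to \<open>g(0)\<close> and two coefficients of \<open>h\<close>
  with frequencies tending to infinity.
\<close>
lemma Fourier_series_at_0:
  fixes g :: "real \<Rightarrow> complex"
  assumes lip: "K-lipschitz_on UNIV g"
  shows "(\<lambda>N. \<Sum>k\<in>{-int N..int N}. fcoef g k) \<longlonglongrightarrow> g 0"
proof -
  define h where "h = (\<lambda>x. (g x - g 0) / (cis x - 1))"
  have gc: "continuous_on UNIV g"
    using lip by (rule lipschitz_on_continuous_on)
  have [measurable]: "g \<in> borel_measurable borel" "cis \<in> borel_measurable borel"
    by (auto intro!: borel_measurable_continuous_onI gc continuous_intros)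
  have K0: "0 \<le> K" using lip by (rule lipschitz_on_nonneg)
  have hm: "h \<in> borel_measurable borel"
    unfolding h_def by measurable
  have gl: "cmod (g x - g 0) \<le> K * \<bar>x\<bar>" for x
    using lipschitz_on_normD[OF lip, of x 0] by simp
  have hb: "cmod (h x) \<le> 2 * K" if "x \<in> {-pi..pi}" for x
  proof (cases "x = 0")
    case False
    have j: "\<bar>x\<bar> \<le> 2 * cmod (cis x - 1)" using that by (intro abs_le_norm_cis_minus_one) auto
    then have p: "cmod (cis x - 1) > 0" using False by auto
    have "cmod (g x - g 0) \<le> 2 * K * cmod (cis x - 1)"
      using gl[of x] mult_left_mono[OF j K0] by (simp add: algebra_simps)
    then show ?thesis using p by (simp add: h_def norm_divide field_simps)
  qed (use K0 in \<open>simp add: h_def\<close>)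
  \<comment> \<open>At \<open>x = 0\<close> the quotient has the default value \<open>0\<close>, and the identity still holds.\<close>
  have gh: "g x = g 0 + h x * cis x - h x" if "x \<in> {-pi..pi}" for x
  proof (cases "x = 0")
    case False
    have "\<bar>x\<bar> \<le> 2 * cmod (cis x - 1)"
      using that by (intro abs_le_norm_cis_minus_one) auto
    then have "cis x - 1 \<noteq> 0" using False by auto
    then show ?thesis unfolding h_def by (simp add: divide_simps) (simp add: algebra_simps)
  qed (simp add: h_def)
  have he: "integrable circle (\<lambda>x. h x * cis (- (of_int k * x)))" for k
  proof (rule integrable_circle_bounded)
    have "(\<lambda>x. cis (- (real_of_int k * x))) \<in> borel_measurable borel"
      by (intro borel_measurable_continuous_onI continuous_intros)
    then show "(\<lambda>x. h x * cis (- (real_of_int k * x))) \<in> borel_measurable borel"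
      using hm by (intro borel_measurable_times) auto
  qed (use hb in \<open>auto simp: norm_mult\<close>)
  have ee: "integrable circle (\<lambda>x. g 0 * cis (of_int (-k) * x))" for k
    by (intro integrable_circle_continuous continuous_intros)
  have coef: "fcoef g k = (if k = 0 then g 0 else 0) + (fcoef h (k - 1) - fcoef h k)" for k
  proof -
    have "(\<integral>x. g x * cis (- (of_int k * x)) \<partial>circle) =
       (\<integral>x. g 0 * cis (of_int (-k) * x) + (h x * cis (- (of_int (k - 1) * x)) - h x * cis (- (of_int k * x))) \<partial>circle)"
    proof (rule Bochner_Integration.integral_cong[OF refl])
      fix x assume "x \<in> space circle"
      then have x: "x \<in> {-pi..pi}" by simp
      have "cis (- (of_int (k - 1) * x)) = cis x * cis (- (of_int k * x))"
        by (subst cis_mult) (simp add: algebra_simps)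
      then show "g x * cis (- (of_int k * x)) = g 0 * cis (of_int (-k) * x) + (h x * cis (- (of_int (k - 1) * x)) - h x * cis (- (of_int k * x)))"
        by (subst gh[OF x]) (simp add: algebra_simps)
    qed
    also have "\<dots> = g 0 * (\<integral>x. cis (of_int (-k) * x) \<partial>circle) +
        ((\<integral>x. h x * cis (- (of_int (k - 1) * x)) \<partial>circle) - (\<integral>x. h x * cis (- (of_int k * x)) \<partial>circle))"
      using he ee by (subst Bochner_Integration.integral_add; (subst Bochner_Integration.integral_diff)?) (auto simp del: of_int_minus of_int_diff)
    finally show ?thesis
      unfolding fcoef_def by (subst (asm) integral_circle_cis) (auto simp: field_simps)
  qed
  have "(\<Sum>k\<in>{-int N..int N}. fcoef g k) = g 0 + (fcoef h (- int N - 1) - fcoef h (int N))" for N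
    unfolding coef by (subst sum.distrib, subst sum_telescope_symmetric) simp
  moreover have "(\<lambda>N. fcoef h (- int N - 1)) \<longlonglongrightarrow> 0" "(\<lambda>N. fcoef h (int N)) \<longlonglongrightarrow> 0"
    by (rule Riemann_Lebesgue[OF hm hb]; auto simp: inj_def)+
  then have "(\<lambda>N. g 0 + (fcoef h (- int N - 1) - fcoef h (int N))) \<longlonglongrightarrow> g 0 + (0 - 0)"
    by (intro tendsto_intros)
  ultimately show ?thesis by simp
qed

lemma lipschitz_on_shift:
  fixes g :: "real \<Rightarrow> 'a :: metric_space"
  assumes "K-lipschitz_on UNIV g"
  shows "K-lipschitz_on UNIV (\<lambda>x. g (x + a))"
proof (rule lipschitz_onI)
  show "dist (g (x + a)) (g (y + a)) \<le> K * dist x y" for x y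
    using lipschitz_onD[OF assms, of "x + a" "y + a"] by simp
qed (use lipschitz_on_nonneg[OF assms] in simp)

lemma Fourier_series_Lipschitz:
  fixes g :: "real \<Rightarrow> complex"
  assumes lip: "K-lipschitz_on UNIV g" and per: "\<And>x. g (x + 2 * pi) = g x"
  shows "(\<lambda>N. \<Sum>k\<in>{-int N..int N}. fcoef g k * cis (of_int k * x)) \<longlonglongrightarrow> g x"
proof -
  have l: "K-lipschitz_on UNIV (\<lambda>y. g (y + x))"
    using lip by (rule lipschitz_on_shift)
  have "fcoef (\<lambda>y. g (y + x)) k = fcoef g k * cis (of_int k * x)" for k
    by (subst fcoef_shift[OF per lipschitz_on_continuous_on[OF lip]]) simp
  with Fourier_series_at_0[OF l] show ?thesis by simp
qed

text \<open>
  Fatou's lemma for the symmetric partial sums, whose norms are at most the right-hand side.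
\<close>
lemma Parseval_Lipschitz:
  fixes g :: "real \<Rightarrow> complex"
  assumes lip: "K-lipschitz_on UNIV g" and per: "\<And>x. g (x + 2 * pi) = g x"
  shows "(\<integral>\<^sup>+x. ennreal ((cmod (g x))\<^sup>2) \<partial>circle) \<le>
           ennreal (2 * pi) * (\<integral>\<^sup>+k. ennreal ((cmod (fcoef g k))\<^sup>2) \<partial>count_space UNIV)"
    (is "_ \<le> ?R")
proof -
  let ?S = "\<lambda>N x. \<Sum>k\<in>{-int N..int N}. fcoef g k * cis (of_int k * x)"
  have c: "continuous_on UNIV (?S N)" for N
    by (intro continuous_intros)
  have m: "(\<lambda>x. ennreal ((cmod (?S N x))\<^sup>2)) \<in> borel_measurable circle" for N
    by (intro measurable_circle measurable_compose[OF _ measurable_ennreal] borel_measurable_continuous_onI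
       continuous_intros)
  have "(\<integral>\<^sup>+x. ennreal ((cmod (?S N x))\<^sup>2) \<partial>circle) \<le> ?R" for N
  proof -
    have "(\<integral>\<^sup>+x. ennreal ((cmod (?S N x))\<^sup>2) \<partial>circle) = ennreal (\<integral>x. (cmod (?S N x))\<^sup>2 \<partial>circle)"
      by (intro nn_integral_eq_integral integrable_circle_continuous continuous_intros) auto
    also have "(\<integral>x. (cmod (?S N x))\<^sup>2 \<partial>circle) = 2 * pi * (\<Sum>k\<in>{-int N..int N}. (cmod (fcoef g k))\<^sup>2)"
      using integral_circle_trig_distance[of "\<lambda>_. 0" 0 "{-int N..int N}" "fcoef g"]
      by (simp add: fcoef_def[of "\<lambda>_. 0"])
    also have "ennreal \<dots> = ennreal (2 * pi) * (\<Sum>k\<in>{-int N..int N}. ennreal ((cmod (fcoef g k))\<^sup>2))"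
      by (subst ennreal_mult) (auto intro!: sum_nonneg)
    also have "(\<Sum>k\<in>{-int N..int N}. ennreal ((cmod (fcoef g k))\<^sup>2)) =
        (\<integral>\<^sup>+k. ennreal ((cmod (fcoef g k))\<^sup>2) * indicator {-int N..int N} k \<partial>count_space UNIV)"
      by (subst nn_integral_count_space_indicator[symmetric]) (auto simp: nn_integral_count_space_finite)
    also have "\<dots> \<le> (\<integral>\<^sup>+k. ennreal ((cmod (fcoef g k))\<^sup>2) \<partial>count_space UNIV)"
      by (intro nn_integral_mono) (auto split: split_indicator)
    finally show ?thesis by (simp add: mult_left_mono)
  qed
  note bound = this
  have "(\<integral>\<^sup>+x. ennreal ((cmod (g x))\<^sup>2) \<partial>circle) = (\<integral>\<^sup>+x. liminf (\<lambda>N. ennreal ((cmod (?S N x))\<^sup>2)) \<partial>circle)"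
  proof (rule nn_integral_cong)
    fix x
    have "(\<lambda>N. ennreal ((cmod (?S N x))\<^sup>2)) \<longlonglongrightarrow> ennreal ((cmod (g x))\<^sup>2)"
      by (intro tendsto_intros Fourier_series_Lipschitz[OF assms])
    then show "ennreal ((cmod (g x))\<^sup>2) = liminf (\<lambda>N. ennreal ((cmod (?S N x))\<^sup>2))"
      by (rule lim_imp_Liminf[OF trivial_limit_sequentially, symmetric])
  qed
  also have "\<dots> \<le> liminf (\<lambda>N. \<integral>\<^sup>+x. ennreal ((cmod (?S N x))\<^sup>2) \<partial>circle)"
    using m by (rule nn_integral_liminf)
  also have "\<dots> \<le> ?R"
    using bound by (intro Liminf_le) auto
  finally show ?thesis .
qed

section \<open>Parseval inequalities for derivatives of Lipschitz functions\<close>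

lemma cmod_cis_minus_one_le: "cmod (cis t - 1) \<le> \<bar>t\<bar>"
proof (rule power2_le_imp_le)
  have "(cmod (cis t - 1))\<^sup>2 = (2 * sin (t / 2))\<^sup>2"
    using cos_double_sin[of "t / 2"] by (simp add: cmod_cis_minus_one_sq power_mult_distrib)
  also have "\<dots> \<le> (2 * (t / 2))\<^sup>2"
    using abs_sin_x_le_abs_x[of "t / 2"] by (simp only: power_mult_distrib abs_le_square_iff) simp
  finally show "(cmod (cis t - 1))\<^sup>2 \<le> \<bar>t\<bar>\<^sup>2" by simp
qed simp

lemma integrable_fcoef:
  assumes "continuous_on UNIV f"
  shows "integrable circle (\<lambda>x. f x * cis (- (of_int k * x)))"
  by (intro integrable_circle_continuous continuous_intros assms)

lemma fcoef_diff:
  assumes "continuous_on UNIV f" "continuous_on UNIV g"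
  shows "fcoef (\<lambda>x. f x - g x) k = fcoef f k - fcoef g k"
  using integrable_fcoef[OF assms(1)] integrable_fcoef[OF assms(2)]
  by (simp add: fcoef_def left_diff_distrib diff_divide_distrib)

lemma fcoef_mult: "fcoef (\<lambda>x. c * f x) k = c * fcoef f k"
  by (simp add: fcoef_def mult.assoc)

lemma fcoef_shift_diff:
  assumes "\<And>x. f (x + 2 * pi) = f x" and cont: "continuous_on UNIV f"
  shows "fcoef (\<lambda>x. f (x + z) - f x) k = (cis (of_int k * z) - 1) * fcoef f k"
proof -
  have "continuous_on UNIV (\<lambda>x. f (x + z))"
    by (intro continuous_on_compose2[OF cont] continuous_intros) auto
  then have "fcoef (\<lambda>x. f (x + z) - f x) k = fcoef (\<lambda>x. f (x + z)) k - fcoef f k"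
    by (intro fcoef_diff cont)
  then show ?thesis
    by (simp add: fcoef_shift[OF assms] algebra_simps)
qed

text \<open>
  Integration by parts, without boundary terms because of periodicity.
\<close>
lemma fcoef_derivative:
  assumes W: "\<And>x. (W has_vector_derivative w x) (at x)" and cont: "continuous_on UNIV w"
    and per: "\<And>x. W (x + 2 * pi) = W x"
  shows "fcoef w k = \<i> * of_int k * fcoef W k"
proof -
  let ?e = "\<lambda>x. cis (- (of_int k * x))"
  have Wc: "continuous_on UNIV W"
    by (intro continuous_at_imp_continuous_on ballI has_vector_derivative_continuous[OF W])
  have d: "((\<lambda>x. W x * ?e x) has_vector_derivative w x * ?e x - \<i> * of_int k * (W x * ?e x)) (at x)" for x
    using has_vector_derivative_mult[OF W has_vector_derivative_cis[of "- of_int k" x UNIV]]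
    by (simp add: algebra_simps)
  have "(\<integral>x. w x * ?e x - \<i> * of_int k * (W x * ?e x) \<partial>circle) = W pi * ?e pi - W (-pi) * ?e (-pi)"
    by (rule integral_circle_FTC[OF d]) (intro continuous_intros cont Wc)
  also have "\<dots> = 0"
  proof -
    have "?e pi * cis (2 * pi * of_int k) = ?e (-pi)"
      by (subst cis_mult) (simp add: algebra_simps)
    moreover have "cis (2 * pi * of_int k) = 1" by simp
    ultimately have "?e pi = ?e (-pi)" by (simp only: mult_1_right)
    then show ?thesis using per[of "-pi"] by simp
  qed
  finally have "(\<integral>x. w x * ?e x \<partial>circle) = \<i> * of_int k * (\<integral>x. W x * ?e x \<partial>circle)"
    using integrable_fcoef[OF cont] integrable_fcoef[OF Wc] by simp
  then show ?thesis by (simp add: fcoef_def)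
qed

text \<open>
  Forward difference quotients along the fixed sequence of steps \<open>1/(n+1)\<close>: the limit of a sequence of
  continuous functions is a Borel function, which makes the derivative of a curve measurable.
\<close>
definition diff_quot :: "nat \<Rightarrow> (real \<Rightarrow> 'a :: real_normed_vector) \<Rightarrow> real \<Rightarrow> 'a" where
  "diff_quot n f x = real (Suc n) *\<^sub>R (f (x + 1 / real (Suc n)) - f x)"

lemma diff_quot_tendsto:
  assumes "(f has_vector_derivative f') (at x)"
  shows "(\<lambda>n. diff_quot n f x) \<longlonglongrightarrow> f'"
proof -
  have lim: "((\<lambda>y. (f y - (f x + (y - x) *\<^sub>R f')) /\<^sub>R norm (y - x)) \<longlongrightarrow> 0) (at x)"
    using assms unfolding has_vector_derivative_def has_derivative_within by (simp add: divide_inverse_commute)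
  have "filterlim (\<lambda>n. x + 1 / real (Suc n)) (at x) sequentially"
  proof (rule filterlim_atI)
    have "(\<lambda>n. x + 1 / real (Suc n)) \<longlonglongrightarrow> x + 0"
      by (intro tendsto_intros LIMSEQ_Suc[OF lim_1_over_n])
    then show "(\<lambda>n. x + 1 / real (Suc n)) \<longlonglongrightarrow> x" by simp
  qed auto
  from filterlim_compose[OF lim this]
  have "(\<lambda>n. diff_quot n f x - f') \<longlonglongrightarrow> 0"
    by (rule Lim_transform_eventually[OF _ always_eventually])
       (auto simp: diff_quot_def scaleR_diff_right divide_inverse_commute scaleR_add_right)
  then show ?thesis by (simp add: LIM_zero_iff)
qed

lemma diff_quot_lipschitz:
  assumes lip: "K-lipschitz_on UNIV f"
  shows "\<exists>L. L-lipschitz_on UNIV (diff_quot n f)"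
proof -
  have "(K + K)-lipschitz_on UNIV (\<lambda>x. f (x + 1 / real (Suc n)) - f x)"
    by (intro lipschitz_on_diff lipschitz_on_shift lip)
  from lipschitz_on_cmult[OF this, of "real (Suc n)"] show ?thesis
    unfolding diff_quot_def[abs_def] by blast
qed

lemma fcoef_diff_quot:
  assumes "\<And>x. f (x + 2 * pi) = f x" and cont: "continuous_on UNIV f"
  shows "cmod (fcoef (diff_quot n f) k) \<le> \<bar>of_int k\<bar> * cmod (fcoef f k)"
proof -
  have "fcoef (diff_quot n f) k = of_real (real (Suc n)) * ((cis (of_int k * (1 / real (Suc n))) - 1) * fcoef f k)"
    unfolding diff_quot_def[abs_def] scaleR_conv_of_real by (simp only: fcoef_mult fcoef_shift_diff[OF assms])
  then have "cmod (fcoef (diff_quot n f) k) = real (Suc n) * cmod (cis (of_int k * (1 / real (Suc n))) - 1) * cmod (fcoef f k)"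
    by (simp only: norm_mult norm_of_real mult.assoc abs_of_nat)
  also have "\<dots> \<le> real (Suc n) * \<bar>of_int k * (1 / real (Suc n))\<bar> * cmod (fcoef f k)"
    by (intro mult_right_mono mult_left_mono cmod_cis_minus_one_le) auto
  also have "\<dots> = \<bar>of_int k\<bar> * cmod (fcoef f k)"
    by (simp add: abs_mult)
  finally show ?thesis .
qed

text \<open>
  The coefficients of a difference quotient of \<open>f\<close> are \<open>(e\<^sup>i\<^sup>k\<^sup>h - 1)/h\<close> times those of \<open>f\<close>, a
  factor bounded by \<open>|k|\<close> uniformly in the step \<open>h\<close>.  Hence the inequality for Lipschitz functions
  bounds the norms of all difference quotients at once, and passes to \<open>g\<close> by Fatou's lemma.
\<close>
lemma Parseval_derivative:
  fixes f g :: "real \<Rightarrow> complex"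
  assumes lip: "K-lipschitz_on UNIV f" and per: "\<And>x. f (x + 2 * pi) = f x"
    and lim: "AE x in circle. (\<lambda>n. diff_quot n f x) \<longlonglongrightarrow> g x"
  shows "(\<integral>\<^sup>+x. ennreal ((cmod (g x))\<^sup>2) \<partial>circle) \<le>
           ennreal (2 * pi) * (\<integral>\<^sup>+k. ennreal ((of_int k)\<^sup>2 * (cmod (fcoef f k))\<^sup>2) \<partial>count_space UNIV)"
    (is "_ \<le> ?R")
proof -
  have cont: "continuous_on UNIV f"
    using lip by (rule lipschitz_on_continuous_on)
  have m: "(\<lambda>x. ennreal ((cmod (diff_quot n f x))\<^sup>2)) \<in> borel_measurable circle" for n
    unfolding diff_quot_def
    by (intro measurable_circle measurable_compose[OF _ measurable_ennreal] borel_measurable_continuous_onI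
       continuous_intros continuous_on_compose2[OF cont]) auto
  have bound: "(\<integral>\<^sup>+x. ennreal ((cmod (diff_quot n f x))\<^sup>2) \<partial>circle) \<le> ?R" for n
  proof -
    obtain L where L: "L-lipschitz_on UNIV (diff_quot n f)"
      using diff_quot_lipschitz[OF lip] by blast
    have p: "diff_quot n f (x + 2 * pi) = diff_quot n f x" for x
      using per[of x] per[of "x + 1 / real (Suc n)"]
      by (simp add: diff_quot_def add.assoc add.commute[of "2 * pi"])
    have "(\<integral>\<^sup>+x. ennreal ((cmod (diff_quot n f x))\<^sup>2) \<partial>circle) \<le>
      ennreal (2 * pi) * (\<integral>\<^sup>+k. ennreal ((cmod (fcoef (diff_quot n f) k))\<^sup>2) \<partial>count_space UNIV)"
      by (rule Parseval_Lipschitz[OF L p])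
    also have "\<dots> \<le> ?R"
    proof (intro mult_left_mono nn_integral_mono ennreal_leI)
      fix k
      show "(cmod (fcoef (diff_quot n f) k))\<^sup>2 \<le> (of_int k)\<^sup>2 * (cmod (fcoef f k))\<^sup>2"
        using power_mono[OF fcoef_diff_quot[OF per cont, of n k], of 2]
        by (simp add: power_mult_distrib)
    qed auto
    finally show ?thesis .
  qed
  have "(\<integral>\<^sup>+x. ennreal ((cmod (g x))\<^sup>2) \<partial>circle) = (\<integral>\<^sup>+x. liminf (\<lambda>n. ennreal ((cmod (diff_quot n f x))\<^sup>2)) \<partial>circle)"
  proof (rule nn_integral_cong_AE, use lim in eventually_elim)
    case (elim x)
    have "(\<lambda>n. ennreal ((cmod (diff_quot n f x))\<^sup>2)) \<longlonglongrightarrow> ennreal ((cmod (g x))\<^sup>2)"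
      by (intro tendsto_intros elim)
    then show ?case
      by (rule lim_imp_Liminf[OF trivial_limit_sequentially, symmetric])
  qed
  also have "\<dots> \<le> liminf (\<lambda>n. \<integral>\<^sup>+x. ennreal ((cmod (diff_quot n f x))\<^sup>2) \<partial>circle)"
    using m by (rule nn_integral_liminf)
  also have "\<dots> \<le> ?R"
    using bound by (intro Liminf_le) auto
  finally show ?thesis .
qed

text \<open>
  Here \<open>d(x+z) - d(x)\<close> is the derivative of the Lipschitz function \<open>f(x+z) - f(x)\<close>.
\<close>
lemma Parseval_velocity_increment:
  fixes f d :: "real \<Rightarrow> complex"
  assumes lip: "K-lipschitz_on UNIV f" and per: "\<And>x. f (x + 2 * pi) = f x"
    and lim: "AE x in lborel. (\<lambda>n. diff_quot n f x) \<longlonglongrightarrow> d x"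
    and lim': "AE x in lborel. (\<lambda>n. diff_quot n f (x + z)) \<longlonglongrightarrow> d (x + z)"
  shows "(\<integral>\<^sup>+x. ennreal ((cmod (d (x + z) - d x))\<^sup>2) \<partial>circle) \<le>
     ennreal (2 * pi) * (\<integral>\<^sup>+k. ennreal ((of_int k)\<^sup>2 * (cmod (fcoef f k))\<^sup>2 * (2 * (1 - cos (of_int k * z)))) \<partial>count_space UNIV)"
proof -
  let ?H = "\<lambda>x. f (x + z) - f x"
  have "(\<integral>\<^sup>+x. ennreal ((cmod (d (x + z) - d x))\<^sup>2) \<partial>circle) \<le>
     ennreal (2 * pi) * (\<integral>\<^sup>+k. ennreal ((of_int k)\<^sup>2 * (cmod (fcoef ?H k))\<^sup>2) \<partial>count_space UNIV)"
  proof (rule Parseval_derivative)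
    show "(K + K)-lipschitz_on UNIV ?H"
      by (intro lipschitz_on_diff lipschitz_on_shift lip)
    show "?H (x + 2 * pi) = ?H x" for x
      using per[of x] per[of "x + z"] by (simp add: algebra_simps)
    have "AE x in lborel. (\<lambda>n. diff_quot n ?H x) \<longlonglongrightarrow> d (x + z) - d x"
      using lim lim'
    proof eventually_elim
      case (elim x)
      have "diff_quot n ?H x = diff_quot n f (x + z) - diff_quot n f x" for n
        by (simp add: diff_quot_def algebra_simps)
      then show ?case using tendsto_diff[OF elim(2,1)] by simp
    qed
    then show "AE x in circle. (\<lambda>n. diff_quot n ?H x) \<longlonglongrightarrow> d (x + z) - d x"
      unfolding AE_circle by auto
  qed
  moreover have "(of_int k)\<^sup>2 * (cmod (fcoef ?H k))\<^sup>2 =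
      (of_int k)\<^sup>2 * (cmod (fcoef f k))\<^sup>2 * (2 * (1 - cos (of_int k * z)))" for k
    by (simp only: fcoef_shift_diff[OF per lipschitz_on_continuous_on[OF lip]] norm_mult
        power_mult_distrib cmod_cis_minus_one_sq mult_ac)
  ultimately show ?thesis by (simp only:)
qed

text \<open>
  With an antiderivative \<open>F\<close> of \<open>f\<close>, the remainder \<open>f(x+z) - f(x) - z d(x)\<close> is the derivative of
  \<open>F(x+z) - F(x) - z f(x)\<close>, which is Lipschitz and periodic.  Its \<open>k\<close>-th coefficient, multiplied by
  \<open>\<i>k\<close>, is \<open>e\<^sup>i\<^sup>k\<^sup>z - 1 - \<i>kz\<close> times that of \<open>f\<close>; at \<open>k = 0\<close> both sides vanish.
\<close>
lemma Parseval_Taylor_remainder: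
  fixes f d :: "real \<Rightarrow> complex"
  assumes lip: "K-lipschitz_on UNIV f" and per: "\<And>x. f (x + 2 * pi) = f x"
    and lim: "AE x in lborel. (\<lambda>n. diff_quot n f x) \<longlonglongrightarrow> d x"
  shows "(\<integral>\<^sup>+x. ennreal ((cmod (f (x + z) - f x - of_real z * d x))\<^sup>2) \<partial>circle) \<le>
     ennreal (2 * pi) * (\<integral>\<^sup>+k. ennreal ((cmod (fcoef f k))\<^sup>2 *
        ((1 - cos (of_int k * z))\<^sup>2 + (sin (of_int k * z) - of_int k * z)\<^sup>2)) \<partial>count_space UNIV)"
proof -
  have fc: "continuous_on UNIV f" using lip by (rule lipschitz_on_continuous_on)
  obtain F c where F: "\<And>x. (F has_vector_derivative f x) (at x)"
      and c: "\<And>x. F (x + 2 * pi) - F x = c"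
    using periodic_antiderivative[of f] per fc by blast
  have Fs: "((\<lambda>x. F (x + a)) has_vector_derivative f (x + a)) (at x)" for x a
    by (rule has_vector_derivative_shift[OF F])
  define W where "W = (\<lambda>x. F (x + z) - F x)"
  let ?w = "\<lambda>x. f (x + z) - f x"
  have W: "(W has_vector_derivative ?w x) (at x)" for x
    unfolding W_def by (rule has_vector_derivative_diff[OF Fs F])
  have Wp: "W (x + 2 * pi) = W x" for x
    using c[of x] c[of "x + z"] by (simp add: W_def algebra_simps)
  have Wl: "(K * \<bar>z\<bar>)-lipschitz_on UNIV W"
  proof (rule bounded_derivative_imp_lipschitz)
    show "(W has_derivative (\<lambda>t. t *\<^sub>R ?w x)) (at x within UNIV)" for x
      using W[of x] by (simp add: has_vector_derivative_def)
    show "onorm (\<lambda>t. t *\<^sub>R ?w x) \<le> K * \<bar>z\<bar>" for x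
    proof (rule onorm_bound)
      show "norm (t *\<^sub>R ?w x) \<le> K * \<bar>z\<bar> * norm t" for t
        using mult_left_mono[OF lipschitz_on_normD[OF lip, of "x + z" x], of "\<bar>t\<bar>"]
        by (simp add: mult_ac)
    qed (use lipschitz_on_nonneg[OF lip] in simp)
  qed (use lipschitz_on_nonneg[OF lip] in auto)
  have Wc: "continuous_on UNIV W" using Wl by (rule lipschitz_on_continuous_on)
  have wc: "continuous_on UNIV ?w"
    by (intro continuous_intros continuous_on_compose2[OF fc]) auto
  let ?H = "\<lambda>x. W x - of_real z * f x"
  have zl: "(\<bar>z\<bar> * K)-lipschitz_on UNIV (\<lambda>x. of_real z * f x)"
    using lipschitz_on_cmult[OF lip, of "z"] by (simp add: scaleR_conv_of_real)
  have "(\<integral>\<^sup>+x. ennreal ((cmod (?w x - of_real z * d x))\<^sup>2) \<partial>circle) \<le>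
     ennreal (2 * pi) * (\<integral>\<^sup>+k. ennreal ((of_int k)\<^sup>2 * (cmod (fcoef ?H k))\<^sup>2) \<partial>count_space UNIV)"
  proof (rule Parseval_derivative)
    show "(K * \<bar>z\<bar> + \<bar>z\<bar> * K)-lipschitz_on UNIV ?H"
      by (intro lipschitz_on_diff Wl zl)
    show "?H (x + 2 * pi) = ?H x" for x
      using per[of x] Wp[of x] by simp
    have "AE x in lborel. (\<lambda>n. diff_quot n ?H x) \<longlonglongrightarrow> ?w x - of_real z * d x"
      using lim
    proof eventually_elim
      case (elim x)
      have "diff_quot n ?H x = diff_quot n W x - of_real z * diff_quot n f x" for n
        by (simp add: diff_quot_def scaleR_conv_of_real algebra_simps)
      moreover have "(\<lambda>n. diff_quot n W x - of_real z * diff_quot n f x) \<longlonglongrightarrow> ?w x - of_real z * d x"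
        by (intro tendsto_intros elim diff_quot_tendsto W)
      ultimately show ?case by simp
    qed
    then show "AE x in circle. (\<lambda>n. diff_quot n ?H x) \<longlonglongrightarrow> ?w x - of_real z * d x"
      unfolding AE_circle by auto
  qed
  moreover have "(of_int k)\<^sup>2 * (cmod (fcoef ?H k))\<^sup>2 = (cmod (fcoef f k))\<^sup>2 *
        ((1 - cos (of_int k * z))\<^sup>2 + (sin (of_int k * z) - of_int k * z)\<^sup>2)" for k
  proof -
    have "fcoef ?H k = fcoef W k - of_real z * fcoef f k"
      by (subst fcoef_diff) (auto intro!: Wc continuous_intros fc simp: fcoef_mult)
    then have "\<i> * of_int k * fcoef ?H k = fcoef ?w k - \<i> * of_int k * of_real z * fcoef f k"
      unfolding fcoef_derivative[OF W wc Wp] by (simp only: right_diff_distrib mult.assoc)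
    also have "\<dots> = (cis (of_int k * z) - 1 - \<i> * of_real (of_int k * z)) * fcoef f k"
      by (simp add: fcoef_shift_diff[OF per fc] algebra_simps)
    finally have "(cmod (\<i> * of_int k * fcoef ?H k))\<^sup>2 =
        (cmod (cis (of_int k * z) - 1 - \<i> * of_real (of_int k * z)))\<^sup>2 * (cmod (fcoef f k))\<^sup>2"
      by (simp only: norm_mult power_mult_distrib)
    also have "(cmod (cis t - 1 - \<i> * of_real t))\<^sup>2 = (1 - cos t)\<^sup>2 + (sin t - t)\<^sup>2" for t
      by (simp add: cmod_power2 power2_commute)
    finally show ?thesis
      by (simp add: norm_mult power_mult_distrib mult.commute)
  qed
  ultimately show ?thesis by (simp only:)
qed

section \<open>Integrals over the frequencies and the displacement\<close>

lemma nn_integral_count_space_le_infsum: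
  fixes f :: "int \<Rightarrow> ennreal"
  shows "(\<integral>\<^sup>+k. f k \<partial>count_space UNIV) \<le> (\<Sum>\<^sub>\<infinity>k\<in>UNIV. f k)"
proof -
  have "(\<integral>\<^sup>+k. f k \<partial>count_space UNIV) =
      (\<integral>\<^sup>+k. (SUP N. f k * indicator {-int N..int N} k) \<partial>count_space UNIV)"
  proof (rule nn_integral_cong)
    fix k :: int
    have "(SUP N. f k * indicator {-int N..int N} k) = f k"
    proof (rule antisym)
      show "(SUP N. f k * indicator {-int N..int N} k) \<le> f k"
        by (intro SUP_least) (auto split: split_indicator)
      show "f k \<le> (SUP N. f k * indicator {-int N..int N} k)"
        by (rule SUP_upper2[of "nat \<bar>k\<bar>"]) (auto split: split_indicator)
    qed
    then show "f k = (SUP N. f k * indicator {-int N..int N} k)" by simp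
  qed
  also have "\<dots> = (SUP N. \<integral>\<^sup>+k. f k * indicator {-int N..int N} k \<partial>count_space UNIV)"
    by (intro nn_integral_monotone_convergence_SUP)
       (auto simp: incseq_def le_fun_def split: split_indicator)
  also have "\<dots> \<le> (\<Sum>\<^sub>\<infinity>k\<in>UNIV. f k)"
  proof (rule SUP_least)
    fix N
    have "(\<integral>\<^sup>+k. f k * indicator {-int N..int N} k \<partial>count_space UNIV) = (\<Sum>k\<in>{-int N..int N}. f k)"
      by (subst nn_integral_count_space_indicator[symmetric]) (auto simp: nn_integral_count_space_finite)
    also have "\<dots> \<le> (\<Sum>\<^sub>\<infinity>k\<in>UNIV. f k)"
      by (subst nonneg_infsum_complete) (auto intro!: SUP_upper)
    finally show "(\<integral>\<^sup>+k. f k * indicator {-int N..int N} k \<partial>count_space UNIV) \<le> (\<Sum>\<^sub>\<infinity>k\<in>UNIV. f k)" .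
  qed
  finally show ?thesis .
qed

text \<open>
  The substitution \<open>u = \<kappa> z\<close>, after folding the negative half line onto the positive one.
\<close>
lemma nn_integral_frequency_scaling:
  fixes \<phi> :: "real \<Rightarrow> real"
  assumes [measurable]: "\<phi> \<in> borel_measurable borel"
    and nonneg: "\<And>u. 0 \<le> \<phi> u" and even: "\<And>u. \<phi> (- u) = \<phi> u" and "\<kappa> \<noteq> 0"
  shows "(\<integral>\<^sup>+z. ennreal (\<phi> (\<kappa> * z) * \<bar>z\<bar> powr (- q)) \<partial>lborel) =
     ennreal (2 * \<bar>\<kappa>\<bar> powr (q - 1)) * (\<integral>\<^sup>+u\<in>{0<..}. ennreal (\<phi> u / u powr q) \<partial>lborel)"
proof -
  define G where "G = (\<lambda>u. ennreal (\<phi> u * \<bar>u\<bar> powr (- q)))"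
  have [measurable]: "G \<in> borel_measurable borel" unfolding G_def by measurable
  let ?P = "\<lambda>u. G u * indicator {0<..} u"
  have half: "(\<integral>\<^sup>+u. ?P u \<partial>lborel) = (\<integral>\<^sup>+u\<in>{0<..}. ennreal (\<phi> u / u powr q) \<partial>lborel)"
    by (intro nn_integral_cong) (auto simp: G_def powr_minus divide_inverse split: split_indicator)
  have "(\<integral>\<^sup>+u. G u \<partial>lborel) = (\<integral>\<^sup>+u. ?P u + ?P (0 + (-1) * u) \<partial>lborel)"
    by (intro nn_integral_cong) (auto simp: G_def even split: split_indicator)
  also have "\<dots> = (\<integral>\<^sup>+u. ?P u \<partial>lborel) + (\<integral>\<^sup>+u. ?P (0 + (-1) * u) \<partial>lborel)"
    by (intro nn_integral_add) measurable
  also have "(\<integral>\<^sup>+u. ?P (0 + (-1) * u) \<partial>lborel) = (\<integral>\<^sup>+u. ?P u \<partial>lborel)"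
    by (subst nn_integral_real_affine[of ?P "-1" 0]) auto
  finally have full: "(\<integral>\<^sup>+u. G u \<partial>lborel) = 2 * (\<integral>\<^sup>+u. ?P u \<partial>lborel)"
    by (simp add: mult_2)
  have "ennreal (\<phi> (\<kappa> * z) * \<bar>z\<bar> powr (- q)) = ennreal (\<bar>\<kappa>\<bar> powr q) * G (0 + \<kappa> * z)" for z
  proof -
    have "\<bar>z\<bar> powr (- q) = \<bar>\<kappa>\<bar> powr q * \<bar>\<kappa> * z\<bar> powr (- q)"
      using \<open>\<kappa> \<noteq> 0\<close> by (simp add: abs_mult powr_mult powr_minus)
    then show ?thesis
      by (simp add: G_def ennreal_mult[symmetric] nonneg mult_ac)
  qed
  then have "(\<integral>\<^sup>+z. ennreal (\<phi> (\<kappa> * z) * \<bar>z\<bar> powr (- q)) \<partial>lborel) =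
      ennreal (\<bar>\<kappa>\<bar> powr q) * (\<integral>\<^sup>+z. G (0 + \<kappa> * z) \<partial>lborel)"
    by (simp only:) (intro nn_integral_cmult, measurable)
  also have "\<bar>\<kappa>\<bar> powr q = \<bar>\<kappa>\<bar> powr (q - 1) * \<bar>\<kappa>\<bar>"
    using \<open>\<kappa> \<noteq> 0\<close> by (simp add: powr_diff)
  also have "ennreal (\<bar>\<kappa>\<bar> powr (q - 1) * \<bar>\<kappa>\<bar>) * (\<integral>\<^sup>+z. G (0 + \<kappa> * z) \<partial>lborel) =
      ennreal (\<bar>\<kappa>\<bar> powr (q - 1)) * (\<integral>\<^sup>+u. G u \<partial>lborel)"
    using \<open>\<kappa> \<noteq> 0\<close> by (subst nn_integral_real_affine[of G \<kappa> 0]) (auto simp: ennreal_mult mult.assoc)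
  also have "\<dots> = ennreal (2 * \<bar>\<kappa>\<bar> powr (q - 1)) * (\<integral>\<^sup>+u. ?P u \<partial>lborel)"
    unfolding full by (simp add: ennreal_mult mult_ac)
  finally show ?thesis unfolding half .
qed

text \<open>
  Tonelli's theorem followed by scaling, with the domain in \<open>z\<close> enlarged from a period to the line.
  The enlargement is the only loss.  The frequency \<open>k = 0\<close> cannot be scaled but has \<open>\<phi> 0 = 0\<close>.
\<close>
lemma nn_integral_Fourier_weight:
  fixes \<phi> :: "real \<Rightarrow> real" and a :: "int \<Rightarrow> ennreal"
  assumes [measurable]: "\<phi> \<in> borel_measurable borel"
    and nonneg: "\<And>u. 0 \<le> \<phi> u" and even: "\<And>u. \<phi> (- u) = \<phi> u" and zero: "\<phi> 0 = 0"
  shows "(\<integral>\<^sup>+z\<in>{-pi..pi}. ennreal (\<bar>z\<bar> powr (- q)) *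
       (\<integral>\<^sup>+k. a k * ennreal (\<phi> (of_int k * z)) \<partial>count_space UNIV) \<partial>lborel)
     \<le> 2 * (\<integral>\<^sup>+u\<in>{0<..}. ennreal (\<phi> u / u powr q) \<partial>lborel) *
        (\<integral>\<^sup>+k. a k * ennreal (\<bar>of_int k\<bar> powr (q - 1)) \<partial>count_space UNIV)"
    (is "?L \<le> 2 * ?I * _")
proof -
  let ?w = "\<lambda>k z. ennreal (\<phi> (of_int k * z) * \<bar>z\<bar> powr (- q))"
  have "?L \<le> (\<integral>\<^sup>+z. (\<integral>\<^sup>+k. a k * ?w k z \<partial>count_space UNIV) \<partial>lborel)"
  proof (rule nn_integral_mono)
    fix z
    have "ennreal (\<bar>z\<bar> powr (- q)) * (\<integral>\<^sup>+k. a k * ennreal (\<phi> (of_int k * z)) \<partial>count_space UNIV) =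
      (\<integral>\<^sup>+k. a k * ?w k z \<partial>count_space UNIV)"
      by (subst nn_integral_cmult[symmetric])
         (auto intro!: nn_integral_cong simp: ennreal_mult nonneg mult_ac)
    then show "ennreal (\<bar>z\<bar> powr (- q)) *
       (\<integral>\<^sup>+k. a k * ennreal (\<phi> (of_int k * z)) \<partial>count_space UNIV) * indicator {-pi..pi} z \<le>
       (\<integral>\<^sup>+k. a k * ?w k z \<partial>count_space UNIV)"
      by (auto split: split_indicator)
  qed
  also have "\<dots> = (\<integral>\<^sup>+k. (\<integral>\<^sup>+z. a k * ?w k z \<partial>lborel) \<partial>count_space UNIV)"
    by (rule nn_integral_count_space_nn_integral) (auto intro!: borel_measurable_times)
  also have "\<dots> \<le> (\<integral>\<^sup>+k. (2 * ?I) * (a k * ennreal (\<bar>of_int k\<bar> powr (q - 1))) \<partial>count_space UNIV)"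
  proof (rule nn_integral_mono)
    fix k :: int
    have "(\<integral>\<^sup>+z. a k * ?w k z \<partial>lborel) = a k * (\<integral>\<^sup>+z. ?w k z \<partial>lborel)"
      by (rule nn_integral_cmult) measurable
    also have "\<dots> \<le> (2 * ?I) * (a k * ennreal (\<bar>of_int k\<bar> powr (q - 1)))"
    proof (cases "k = 0")
      case False
      then have "(\<integral>\<^sup>+z. ?w k z \<partial>lborel) = ennreal (2 * \<bar>of_int k\<bar> powr (q - 1)) * ?I"
        by (intro nn_integral_frequency_scaling nonneg even) auto
      then show ?thesis by (simp add: ennreal_mult mult_ac)
    qed (simp add: zero)
    finally show "(\<integral>\<^sup>+z. a k * ?w k z \<partial>lborel) \<le> \<dots>" .
  qed
  also have "\<dots> = 2 * ?I * (\<integral>\<^sup>+k. a k * ennreal (\<bar>of_int k\<bar> powr (q - 1)) \<partial>count_space UNIV)"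
    by (rule nn_integral_cmult) simp
  finally show ?thesis .
qed

lemma AE_lborel_shift:
  fixes z :: real
  assumes "AE x in lborel. P x"
  shows "AE x in lborel. P (x + z)"
proof -
  obtain N where N: "\<And>x. x \<in> space lborel - N \<Longrightarrow> P x" "N \<in> null_sets lborel"
    using assms by (rule AE_E3) blast
  then have [measurable]: "N \<in> sets borel" by auto
  have "(\<integral>\<^sup>+x. indicator N x \<partial>lborel) = 0"
    using N by (simp add: null_sets_def)
  then have "(\<integral>\<^sup>+x. indicator N (z + 1 * x) \<partial>lborel) = 0"
    by (subst (asm) nn_integral_real_affine[of _ 1 z]) auto
  then have "AE x in lborel. (indicator N (z + 1 * x) :: ennreal) = 0"
    by (subst (asm) nn_integral_0_iff_AE) auto
  then show ?thesis
  proof eventually_elim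
    case (elim x)
    then show ?case using N(1)[of "x + z"] by (auto simp: add.commute split: split_indicator_asm)
  qed
qed

lemma nn_integral_two_powers_finite:
  fixes f :: "real \<Rightarrow> real"
  assumes "\<alpha> > -1" "\<beta> < -1" "0 \<le> C"
    and near: "\<And>u. 0 < u \<Longrightarrow> u \<le> 1 \<Longrightarrow> f u \<le> C * u powr \<alpha>"
    and far: "\<And>u. 1 \<le> u \<Longrightarrow> f u \<le> C * u powr \<beta>"
  shows "(\<integral>\<^sup>+u\<in>{0<..}. ennreal (f u) \<partial>lborel) < \<infinity>"
proof -
  have "(\<integral>\<^sup>+u\<in>{0<..}. ennreal (f u) \<partial>lborel) \<le>
     (\<integral>\<^sup>+u. ennreal C * (ennreal (u powr \<alpha>) * indicator {0..1} u) + ennreal C * (ennreal (u powr \<beta>) * indicator {1..} u) \<partial>lborel)"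
  proof (rule nn_integral_mono)
    fix u :: real
    show "ennreal (f u) * indicator {0<..} u \<le>
      ennreal C * (ennreal (u powr \<alpha>) * indicator {0..1} u) + ennreal C * (ennreal (u powr \<beta>) * indicator {1..} u)"
    proof (cases "0 < u")
      case True
      then show ?thesis
      proof (cases "u < 1")
        case True
        with \<open>0 < u\<close> near[of u] \<open>0 \<le> C\<close> show ?thesis
          by (auto simp: ennreal_mult[symmetric] intro!: ennreal_leI)
      next
        case False
        have "ennreal (f u) \<le> ennreal C * ennreal (u powr \<beta>)"
          using False far[of u] \<open>0 \<le> C\<close> by (auto simp: ennreal_mult[symmetric] intro!: ennreal_leI)
        then show ?thesis
          using False \<open>0 < u\<close> by (simp add: add_increasing)
      qed
    qed simp
  qed
  also have "\<dots> = ennreal C * (\<integral>\<^sup>+u. ennreal (u powr \<alpha>) * indicator {0..1} u \<partial>lborel)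
      + ennreal C * (\<integral>\<^sup>+u. ennreal (u powr \<beta>) * indicator {1..} u \<partial>lborel)"
    by (subst nn_integral_add; (subst nn_integral_cmult)?; (subst nn_integral_cmult)?) auto
  also have "(\<integral>\<^sup>+u. ennreal (u powr \<alpha>) * indicator {0..1} u \<partial>lborel) = ennreal (1 powr (\<alpha> + 1) / (\<alpha> + 1))"
    by (intro nn_integral_has_integral_lebesgue' has_integral_powr_from_0 assms) auto
  also have "(\<integral>\<^sup>+u. ennreal (u powr \<beta>) * indicator {1..} u \<partial>lborel) = ennreal (- (1 powr (\<beta> + 1)) / (\<beta> + 1))"
    by (intro nn_integral_has_integral_lebesgue' has_integral_powr_to_inf assms) auto
  finally show ?thesis
    by (simp add: ennreal_mult[symmetric] le_less_trans ennreal_mult_less_top)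
qed

lemma one_minus_cos_le: "1 - cos (u::real) \<le> u\<^sup>2 / 2"
  using power_mono[OF cmod_cis_minus_one_le[of u], of 2] by (simp add: cmod_cis_minus_one_sq)

text \<open>
  Near \<open>0\<close> the integrand is of order \<open>u\<^sup>-\<^sup>p\<close>, integrable since \<open>p < 1\<close>; near infinity it is at
  most of order \<open>u\<^sup>-\<^sup>2\<^sup>-\<^sup>p\<close>, integrable since \<open>p > -1\<close>.
\<close>
lemma nn_integral_velocity_symbol_finite:
  assumes "-1 < p" "p < 1"
  shows "(\<integral>\<^sup>+u\<in>{0<..}. ennreal ((1 - cos u) / u powr (2 + p)) \<partial>lborel) < \<infinity>"
proof (rule nn_integral_two_powers_finite[of "-p" "-(2 + p)" 2])
  fix u :: real assume u: "0 < u" "u \<le> 1"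
  have "(1 - cos u) / u powr (2 + p) \<le> (u\<^sup>2 / 2) / u powr (2 + p)"
    by (intro divide_right_mono one_minus_cos_le) auto
  also have "\<dots> = 1 / 2 * u powr (-p)"
    using u by (simp add: powr_add powr_minus field_simps)
  also have "\<dots> \<le> 2 * u powr (-p)" by simp
  finally show "(1 - cos u) / u powr (2 + p) \<le> 2 * u powr (-p)" .
next
  fix u :: real assume u: "1 \<le> u"
  have "(1 - cos u) / u powr (2 + p) \<le> 2 / u powr (2 + p)"
    by (intro divide_right_mono) (use cos_ge_minus_one[of u] in auto)
  then show "(1 - cos u) / u powr (2 + p) \<le> 2 * u powr (- (2 + p))"
    by (simp only: powr_minus divide_inverse)
qed (use assms in auto)

text \<open>
  The same two powers serve as bounds: the numerator is at most of order \<open>u\<^sup>4\<close> near \<open>0\<close>, where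
  \<open>sin u - u\<close> is even of order \<open>u\<^sup>3\<close>, and of order \<open>u\<^sup>2\<close> near infinity.
\<close>
lemma nn_integral_Taylor_symbol_finite:
  assumes "-1 < p" "p < 1"
  shows "(\<integral>\<^sup>+u\<in>{0<..}. ennreal (((1 - cos u)\<^sup>2 + (sin u - u)\<^sup>2) / u powr (4 + p)) \<partial>lborel) < \<infinity>"
proof (rule nn_integral_two_powers_finite[of "-p" "-(2 + p)" 8])
  fix u :: real assume u: "0 < u" "u \<le> 1"
  have "(1 - cos u)\<^sup>2 \<le> (u\<^sup>2 / 2)\<^sup>2"
    using one_minus_cos_le[of u] by (intro power_mono) auto
  moreover have "(sin u - u)\<^sup>2 \<le> (u\<^sup>2)\<^sup>2"
  proof (rule power2_le_iff_abs_le[THEN iffD2])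
    have "\<bar>sin u - u\<bar> \<le> u ^ 3 / 6" using u by (intro sin_cubic_bound) auto
    also have "\<dots> \<le> u ^ 3" using u by auto
    also have "\<dots> \<le> u\<^sup>2" using u by (intro power_decreasing) auto
    finally show "\<bar>sin u - u\<bar> \<le> u\<^sup>2" .
  qed auto
  ultimately have "4 * (1 - cos u)\<^sup>2 \<le> u ^ 4" "(sin u - u)\<^sup>2 \<le> u ^ 4"
    by (simp_all add: power_divide flip: power_mult)
  moreover have "0 \<le> u ^ 4" by simp
  ultimately have "(1 - cos u)\<^sup>2 + (sin u - u)\<^sup>2 \<le> 8 * u ^ 4"
    using zero_le_power2[of "1 - cos u"] by linarith
  then have "((1 - cos u)\<^sup>2 + (sin u - u)\<^sup>2) / u powr (4 + p) \<le> 8 * u ^ 4 / u powr (4 + p)"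
    by (intro divide_right_mono) auto
  also have "u ^ 4 = u powr 4" using u by (simp add: powr_numeral)
  also have "8 * u powr 4 / u powr (4 + p) = 8 * u powr (-p)"
    using u by (simp add: powr_add powr_minus field_simps)
  finally show "((1 - cos u)\<^sup>2 + (sin u - u)\<^sup>2) / u powr (4 + p) \<le> 8 * u powr (-p)" .
next
  fix u :: real assume u: "1 \<le> u"
  have "(1 - cos u)\<^sup>2 \<le> 2\<^sup>2"
    using cos_ge_minus_one[of u] by (intro power_mono) auto
  also have "\<dots> \<le> 4 * u\<^sup>2" using u by (simp add: one_le_power)
  finally have c: "(1 - cos u)\<^sup>2 \<le> 4 * u\<^sup>2" .
  have "\<bar>sin u - u\<bar> \<le> 2 * u" using u sin_le_one[of u] sin_ge_minus_one[of u] by linarith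
  then have "\<bar>sin u - u\<bar>\<^sup>2 \<le> (2 * u)\<^sup>2" by (intro power_mono) auto
  with c have "(1 - cos u)\<^sup>2 + (sin u - u)\<^sup>2 \<le> 8 * u\<^sup>2"
    by (simp add: power_mult_distrib)
  then have "((1 - cos u)\<^sup>2 + (sin u - u)\<^sup>2) / u powr (4 + p) \<le> 8 * u\<^sup>2 / u powr (4 + p)"
    by (intro divide_right_mono) auto
  also have "u\<^sup>2 = u powr 2" using u by (simp add: powr_numeral)
  also have "8 * u powr 2 / u powr (4 + p) = 8 * (u powr 2 * u powr (- (4 + p)))"
    by (simp only: powr_minus divide_inverse mult.assoc)
  also have "u powr 2 * u powr (- (4 + p)) = u powr (- (2 + p))"
    by (subst powr_add[symmetric]) simp
  finally show "((1 - cos u)\<^sup>2 + (sin u - u)\<^sup>2) / u powr (4 + p) \<le> 8 * u powr (- (2 + p))" .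
qed (use assms in auto)

section \<open>Difference energies of a closed curve\<close>

lemma power2_norm_vec: "(norm x)\<^sup>2 = (\<Sum>j\<in>UNIV. (norm (x $ j))\<^sup>2)"
  by (simp add: norm_vec_def L2_set_def sum_nonneg)

lemma fourier_coeff_component:
  assumes "continuous_on UNIV \<gamma>"
  shows "fourier_coeff \<gamma> k $ j = fcoef (\<lambda>x. of_real (\<gamma> x $ j)) k"
proof -
  let ?h = "\<lambda>x. complex_of_real (\<gamma> x $ j) * cis (- (of_int k * x))"
  have c: "continuous_on UNIV ?h"
    by (intro continuous_intros assms)
  have e: "exp (- \<i> * of_int k * of_real x) = cis (- (of_int k * x))" for x
    by (simp add: cis_conv_exp mult.assoc)
  have "(LINT x:{-pi..pi}|lebesgue. ?h x) = (\<integral>x. indicator {-pi..pi} x *\<^sub>R ?h x \<partial>lborel)"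
    unfolding set_lebesgue_integral_def
    by (intro integral_completion borel_measurable_scaleR borel_measurable_indicator)
       (auto intro!: borel_measurable_continuous_onI c)
  then show ?thesis
    unfolding fourier_coeff_def fcoef_def vec_lambda_beta e integral_circle by simp
qed

lemma norm_fourier_coeff_sq:
  assumes "continuous_on UNIV \<gamma>"
  shows "(norm (fourier_coeff \<gamma> k))\<^sup>2 = (\<Sum>j\<in>UNIV. (cmod (fcoef (\<lambda>x. of_real (\<gamma> x $ j)) k))\<^sup>2)"
  by (simp add: power2_norm_vec fourier_coeff_component[OF assms])

lemma nn_integral_power2_norm_vec:
  fixes f :: "real \<Rightarrow> real ^ 3"
  assumes [measurable]: "f \<in> borel_measurable borel"
  shows "(\<integral>\<^sup>+x. ennreal ((norm (f x))\<^sup>2) \<partial>circle) =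
     (\<Sum>j\<in>UNIV. \<integral>\<^sup>+x. ennreal ((cmod (of_real (f x $ j)))\<^sup>2) \<partial>circle)"
proof -
  have "(\<lambda>x. f x $ j) \<in> borel_measurable borel" for j
    by (rule measurable_compose[OF assms])
       (intro borel_measurable_continuous_onI continuous_intros)
  then have m: "(\<lambda>x. ennreal ((cmod (of_real (f x $ j)))\<^sup>2)) \<in> borel_measurable circle" for j
    by (intro measurable_circle) simp
  show ?thesis
    by (subst nn_integral_sum[symmetric, OF m]) (simp add: power2_norm_vec sum_ennreal)
qed

lemma lipschitz_on_component:
  fixes \<gamma> :: "real \<Rightarrow> real ^ 3"
  assumes "K-lipschitz_on UNIV \<gamma>"
  shows "K-lipschitz_on UNIV (\<lambda>x. complex_of_real (\<gamma> x $ j))"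
proof (rule lipschitz_onI)
  fix x y
  have "dist (complex_of_real (\<gamma> x $ j)) (complex_of_real (\<gamma> y $ j)) = \<bar>(\<gamma> x - \<gamma> y) $ j\<bar>"
    by (simp add: dist_norm flip: of_real_diff)
  also have "\<dots> \<le> dist (\<gamma> x) (\<gamma> y)"
    unfolding dist_norm by (rule component_le_norm_cart)
  also have "\<dots> \<le> K * dist x y" by (rule lipschitz_onD[OF assms]) auto
  finally show "dist (complex_of_real (\<gamma> x $ j)) (complex_of_real (\<gamma> y $ j)) \<le> K * dist x y" .
qed (use lipschitz_on_nonneg[OF assms] in simp)

lemma diff_quot_component_tendsto:
  assumes "(\<lambda>n. diff_quot n \<gamma> x) \<longlonglongrightarrow> v"
  shows "(\<lambda>n. diff_quot n (\<lambda>x. complex_of_real (\<gamma> x $ j)) x) \<longlonglongrightarrow> of_real (v $ j)"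
proof -
  have "(\<lambda>n. complex_of_real (diff_quot n \<gamma> x $ j)) \<longlonglongrightarrow> of_real (v $ j)"
    by (intro tendsto_intros assms)
  then show ?thesis
    by (simp only: diff_quot_def vector_scaleR_component vector_minus_component real_scaleR_def
        of_real_mult of_real_diff scaleR_conv_of_real[where 'a = complex])
qed

lemma sum_scaled_nn_integral_count_space:
  fixes a :: "'j \<Rightarrow> int \<Rightarrow> real"
  assumes "finite J" "\<And>j k. 0 \<le> a j k"
  shows "(\<Sum>j\<in>J. c * (\<integral>\<^sup>+k. ennreal (a j k) \<partial>count_space UNIV)) =
    c * (\<integral>\<^sup>+k. ennreal (\<Sum>j\<in>J. a j k) \<partial>count_space UNIV)"
  using assms by (simp add: sum_distrib_left[symmetric] nn_integral_sum[symmetric] sum_ennreal)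

text \<open>
  Throughout, \<open>d\<close> is a Borel version of the derivative of a closed Lipschitz curve \<open>\<gamma>\<close>.  The
  inequalities for complex functions are applied to each coordinate and added up.
\<close>
context
  fixes \<gamma> d :: "real \<Rightarrow> real ^ 3" and K :: real
  assumes lip: "K-lipschitz_on UNIV \<gamma>" and per: "\<And>x. \<gamma> (x + 2 * pi) = \<gamma> x"
    and d: "d \<in> borel_measurable borel"
    and lim: "AE x in lborel. (\<lambda>n. diff_quot n \<gamma> x) \<longlonglongrightarrow> d x"
begin

lemma continuous_curve: "continuous_on UNIV \<gamma>"
  using lip by (rule lipschitz_on_continuous_on)

lemma AE_shift_diff_quot: "AE x in lborel. (\<lambda>n. diff_quot n \<gamma> (x + z)) \<longlonglongrightarrow> d (x + z)"
  by (rule AE_lborel_shift[OF lim])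

lemma Parseval_curve_velocity_increment:
  "(\<integral>\<^sup>+x. ennreal ((norm (d (x + z) - d x))\<^sup>2) \<partial>circle) \<le> ennreal (2 * pi) *
     (\<integral>\<^sup>+k. ennreal ((of_int k)\<^sup>2 * (norm (fourier_coeff \<gamma> k))\<^sup>2 * (2 * (1 - cos (of_int k * z)))) \<partial>count_space UNIV)"
proof -
  let ?c = "\<lambda>j k. fcoef (\<lambda>x. of_real (\<gamma> x $ j)) k"
  have "(\<integral>\<^sup>+x. ennreal ((norm (d (x + z) - d x))\<^sup>2) \<partial>circle) =
    (\<Sum>j\<in>UNIV. \<integral>\<^sup>+x. ennreal ((cmod (of_real ((d (x + z) - d x) $ j)))\<^sup>2) \<partial>circle)"
    using d by (intro nn_integral_power2_norm_vec borel_measurable_diff measurable_compose[OF _ d]) auto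
  also have "\<dots> \<le> (\<Sum>j\<in>UNIV. ennreal (2 * pi) * (\<integral>\<^sup>+k. ennreal ((of_int k)\<^sup>2 * (cmod (?c j k))\<^sup>2 * (2 * (1 - cos (of_int k * z)))) \<partial>count_space UNIV))"
  proof (rule sum_mono)
    fix j
    have "AE x in lborel. (\<lambda>n. diff_quot n (\<lambda>x. complex_of_real (\<gamma> x $ j)) x) \<longlonglongrightarrow> of_real (d x $ j)"
      using lim by eventually_elim (rule diff_quot_component_tendsto)
    moreover have "AE x in lborel. (\<lambda>n. diff_quot n (\<lambda>x. complex_of_real (\<gamma> x $ j)) (x + z)) \<longlonglongrightarrow> of_real (d (x + z) $ j)"
      using AE_shift_diff_quot[of z] by eventually_elim (rule diff_quot_component_tendsto)
    ultimately have "(\<integral>\<^sup>+x. ennreal ((cmod (of_real (d (x + z) $ j) - of_real (d x $ j)))\<^sup>2) \<partial>circle) \<le>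
       ennreal (2 * pi) * (\<integral>\<^sup>+k. ennreal ((of_int k)\<^sup>2 * (cmod (?c j k))\<^sup>2 * (2 * (1 - cos (of_int k * z)))) \<partial>count_space UNIV)"
      by (intro Parseval_velocity_increment[OF lipschitz_on_component[OF lip]]) (auto simp: per)
    then show "(\<integral>\<^sup>+x. ennreal ((cmod (of_real ((d (x + z) - d x) $ j)))\<^sup>2) \<partial>circle) \<le>
       ennreal (2 * pi) * (\<integral>\<^sup>+k. ennreal ((of_int k)\<^sup>2 * (cmod (?c j k))\<^sup>2 * (2 * (1 - cos (of_int k * z)))) \<partial>count_space UNIV)"
      by (simp only: vector_minus_component of_real_diff)
  qed
  also have "\<dots> = ennreal (2 * pi) * (\<integral>\<^sup>+k. ennreal (\<Sum>j\<in>UNIV. (of_int k)\<^sup>2 * (cmod (?c j k))\<^sup>2 * (2 * (1 - cos (of_int k * z)))) \<partial>count_space UNIV)"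
    by (rule sum_scaled_nn_integral_count_space) auto
  also have "(\<lambda>k. \<Sum>j\<in>UNIV. (of_int k)\<^sup>2 * (cmod (?c j k))\<^sup>2 * (2 * (1 - cos (of_int k * z)))) =
     (\<lambda>k. (of_int k)\<^sup>2 * (norm (fourier_coeff \<gamma> k))\<^sup>2 * (2 * (1 - cos (of_int k * z))))"
    by (simp only: norm_fourier_coeff_sq[OF continuous_curve] sum_distrib_left sum_distrib_right)
  finally show ?thesis .
qed

lemma Parseval_curve_Taylor_remainder:
  "(\<integral>\<^sup>+x. ennreal ((norm (\<gamma> (x + z) - \<gamma> x - z *\<^sub>R d x))\<^sup>2) \<partial>circle) \<le> ennreal (2 * pi) *
     (\<integral>\<^sup>+k. ennreal ((norm (fourier_coeff \<gamma> k))\<^sup>2 *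
        ((1 - cos (of_int k * z))\<^sup>2 + (sin (of_int k * z) - of_int k * z)\<^sup>2)) \<partial>count_space UNIV)"
proof -
  let ?c = "\<lambda>j k. fcoef (\<lambda>x. of_real (\<gamma> x $ j)) k"
  let ?s = "\<lambda>k::int. (1 - cos (of_int k * z))\<^sup>2 + (sin (of_int k * z) - of_int k * z)\<^sup>2"
  have g: "\<gamma> \<in> borel_measurable borel"
    by (intro borel_measurable_continuous_onI continuous_curve)
  have "(\<integral>\<^sup>+x. ennreal ((norm (\<gamma> (x + z) - \<gamma> x - z *\<^sub>R d x))\<^sup>2) \<partial>circle) =
    (\<Sum>j\<in>UNIV. \<integral>\<^sup>+x. ennreal ((cmod (of_real ((\<gamma> (x + z) - \<gamma> x - z *\<^sub>R d x) $ j)))\<^sup>2) \<partial>circle)"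
    using d g by (intro nn_integral_power2_norm_vec borel_measurable_diff measurable_compose[OF _ g]) auto
  also have "\<dots> \<le> (\<Sum>j\<in>UNIV. ennreal (2 * pi) * (\<integral>\<^sup>+k. ennreal ((cmod (?c j k))\<^sup>2 * ?s k) \<partial>count_space UNIV))"
  proof (rule sum_mono)
    fix j
    have "AE x in lborel. (\<lambda>n. diff_quot n (\<lambda>x. complex_of_real (\<gamma> x $ j)) x) \<longlonglongrightarrow> of_real (d x $ j)"
      using lim by eventually_elim (rule diff_quot_component_tendsto)
    then have "(\<integral>\<^sup>+x. ennreal ((cmod (of_real (\<gamma> (x + z) $ j) - of_real (\<gamma> x $ j) - of_real z * of_real (d x $ j)))\<^sup>2) \<partial>circle) \<le>
       ennreal (2 * pi) * (\<integral>\<^sup>+k. ennreal ((cmod (?c j k))\<^sup>2 * ?s k) \<partial>count_space UNIV)"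
      by (intro Parseval_Taylor_remainder[OF lipschitz_on_component[OF lip]]) (auto simp: per)
    then show "(\<integral>\<^sup>+x. ennreal ((cmod (of_real ((\<gamma> (x + z) - \<gamma> x - z *\<^sub>R d x) $ j)))\<^sup>2) \<partial>circle) \<le>
       ennreal (2 * pi) * (\<integral>\<^sup>+k. ennreal ((cmod (?c j k))\<^sup>2 * ?s k) \<partial>count_space UNIV)"
      by (simp only: vector_minus_component vector_scaleR_component real_scaleR_def of_real_diff of_real_mult)
  qed
  also have "\<dots> = ennreal (2 * pi) * (\<integral>\<^sup>+k. ennreal (\<Sum>j\<in>UNIV. (cmod (?c j k))\<^sup>2 * ?s k) \<partial>count_space UNIV)"
    by (rule sum_scaled_nn_integral_count_space) auto
  also have "(\<lambda>k. \<Sum>j\<in>UNIV. (cmod (?c j k))\<^sup>2 * ?s k) = (\<lambda>k. (norm (fourier_coeff \<gamma> k))\<^sup>2 * ?s k)"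
    by (simp only: norm_fourier_coeff_sq[OF continuous_curve] sum_distrib_right)
  finally show ?thesis .
qed

text \<open>
  The factor \<open>k\<^sup>2\<close> from the derivative and \<open>|k|\<^sup>1\<^sup>+\<^sup>p\<close> from scaling combine to \<open>|k|\<^sup>3\<^sup>+\<^sup>p\<close>.  The constant
  \<open>8\<pi>\<close> is \<open>2\<pi>\<close> from the inequality of Parseval, \<open>2\<close> from \<open>|e\<^sup>i\<^sup>t - 1|\<^sup>2 = 2 (1 - cos t)\<close>, and \<open>2\<close> from the two
  half lines.
\<close>
lemma weighted_velocity_energy_le:
  "(\<integral>\<^sup>+z\<in>{-pi..pi}. ennreal (\<bar>z\<bar> powr (- (2 + p))) *
      (\<integral>\<^sup>+x. ennreal ((norm (d (x + z) - d x))\<^sup>2) \<partial>circle) \<partial>lborel) \<le>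
   ennreal (8 * pi) * (\<integral>\<^sup>+u\<in>{0<..}. ennreal ((1 - cos u) / u powr (2 + p)) \<partial>lborel) * Hdot_norm_sq ((3 + p) / 2) \<gamma>"
    (is "?L \<le> _ * ?I * ?H")
proof -
  let ?a = "\<lambda>k::int. ennreal (4 * pi) * ennreal ((of_int k)\<^sup>2 * (norm (fourier_coeff \<gamma> k))\<^sup>2)"
  let ?S = "\<lambda>z. \<integral>\<^sup>+k. ?a k * ennreal (1 - cos (of_int k * z)) \<partial>count_space UNIV"
  have "?L \<le> (\<integral>\<^sup>+z\<in>{-pi..pi}. ennreal (\<bar>z\<bar> powr (- (2 + p))) * ?S z \<partial>lborel)"
  proof (intro nn_integral_mono mult_right_mono mult_left_mono)
    fix z
    have "ennreal (2 * pi) * ennreal ((of_int k)\<^sup>2 * (norm (fourier_coeff \<gamma> k))\<^sup>2 * (2 * (1 - cos (of_int k * z)))) =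
        ?a k * ennreal (1 - cos (of_int k * z))" for k :: int
      by (simp add: ennreal_mult'[symmetric] mult_ac)
    then show "(\<integral>\<^sup>+x. ennreal ((norm (d (x + z) - d x))\<^sup>2) \<partial>circle) \<le> ?S z"
      using Parseval_curve_velocity_increment[of z] by (simp add: nn_integral_cmult[symmetric])
  qed auto
  also have "\<dots> \<le> 2 * ?I * (\<integral>\<^sup>+k. ?a k * ennreal (\<bar>of_int k\<bar> powr (2 + p - 1)) \<partial>count_space UNIV)"
    by (rule nn_integral_Fourier_weight[where \<phi> = "\<lambda>u. 1 - cos u"]) auto
  also have "(\<integral>\<^sup>+k. ?a k * ennreal (\<bar>of_int k\<bar> powr (2 + p - 1)) \<partial>count_space UNIV) =
     (\<integral>\<^sup>+k. ennreal (4 * pi) * ennreal (\<bar>real_of_int k\<bar> powr (2 * ((3 + p) / 2)) * (norm (fourier_coeff \<gamma> k))\<^sup>2) \<partial>count_space UNIV)"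
  proof (rule nn_integral_cong)
    fix k :: int
    have "(of_int k)\<^sup>2 * \<bar>of_int k\<bar> powr (2 + p - 1) = \<bar>real_of_int k\<bar> powr (2 * ((3 + p) / 2))"
    proof (cases "k = 0")
      case False
      then have "(of_int k)\<^sup>2 = \<bar>real_of_int k\<bar> powr 2" by (simp add: powr_numeral)
      moreover have "2 + (2 + p - 1) = 2 * ((3 + p) / 2)" by (simp add: field_simps)
      ultimately show ?thesis by (simp only: powr_add[symmetric])
    qed simp
    moreover have "(of_int k)\<^sup>2 * (norm (fourier_coeff \<gamma> k))\<^sup>2 * \<bar>of_int k\<bar> powr (2 + p - 1) =
       (of_int k)\<^sup>2 * \<bar>of_int k\<bar> powr (2 + p - 1) * (norm (fourier_coeff \<gamma> k))\<^sup>2"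
      by (simp only: mult_ac)
    ultimately have "(of_int k)\<^sup>2 * (norm (fourier_coeff \<gamma> k))\<^sup>2 * \<bar>of_int k\<bar> powr (2 + p - 1) =
       \<bar>real_of_int k\<bar> powr (2 * ((3 + p) / 2)) * (norm (fourier_coeff \<gamma> k))\<^sup>2"
      by (simp only:)
    then show "?a k * ennreal (\<bar>of_int k\<bar> powr (2 + p - 1)) =
        ennreal (4 * pi) * ennreal (\<bar>real_of_int k\<bar> powr (2 * ((3 + p) / 2)) * (norm (fourier_coeff \<gamma> k))\<^sup>2)"
      by (simp only: mult.assoc ennreal_mult''[symmetric] powr_ge_zero)
  qed
  also have "\<dots> = ennreal (4 * pi) * (\<integral>\<^sup>+k. ennreal (\<bar>real_of_int k\<bar> powr (2 * ((3 + p) / 2)) * (norm (fourier_coeff \<gamma> k))\<^sup>2) \<partial>count_space UNIV)"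
    by (rule nn_integral_cmult) simp
  also have "2 * ?I * \<dots> \<le> 2 * ?I * (ennreal (4 * pi) * ?H)"
    unfolding Hdot_norm_sq_def by (intro mult_left_mono nn_integral_count_space_le_infsum) auto
  also have "\<dots> = ennreal (8 * pi) * ?I * ?H"
  proof -
    have "ennreal (8 * pi) = 2 * ennreal (4 * pi)"
      using ennreal_mult[of 2 "4 * pi"] by simp
    then show ?thesis by (simp only: mult_ac)
  qed
  finally show ?thesis .
qed

text \<open>
  Here the power \<open>|k|\<^sup>3\<^sup>+\<^sup>p\<close> comes from scaling alone.
\<close>
lemma weighted_Taylor_energy_le:
  "(\<integral>\<^sup>+z\<in>{-pi..pi}. ennreal (\<bar>z\<bar> powr (- (4 + p))) *
      (\<integral>\<^sup>+x. ennreal ((norm (\<gamma> (x + z) - \<gamma> x - z *\<^sub>R d x))\<^sup>2) \<partial>circle) \<partial>lborel) \<le>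
   ennreal (4 * pi) * (\<integral>\<^sup>+u\<in>{0<..}. ennreal (((1 - cos u)\<^sup>2 + (sin u - u)\<^sup>2) / u powr (4 + p)) \<partial>lborel) *
     Hdot_norm_sq ((3 + p) / 2) \<gamma>"
    (is "?L \<le> _ * ?I * ?H")
proof -
  let ?a = "\<lambda>k::int. ennreal (2 * pi) * ennreal ((norm (fourier_coeff \<gamma> k))\<^sup>2)"
  let ?\<phi> = "\<lambda>u::real. (1 - cos u)\<^sup>2 + (sin u - u)\<^sup>2"
  let ?S = "\<lambda>z. \<integral>\<^sup>+k. ?a k * ennreal (?\<phi> (of_int k * z)) \<partial>count_space UNIV"
  have "?L \<le> (\<integral>\<^sup>+z\<in>{-pi..pi}. ennreal (\<bar>z\<bar> powr (- (4 + p))) * ?S z \<partial>lborel)"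
  proof (intro nn_integral_mono mult_right_mono mult_left_mono)
    fix z
    show "(\<integral>\<^sup>+x. ennreal ((norm (\<gamma> (x + z) - \<gamma> x - z *\<^sub>R d x))\<^sup>2) \<partial>circle) \<le> ?S z"
      using Parseval_curve_Taylor_remainder[of z]
      by (simp add: nn_integral_cmult[symmetric] ennreal_mult mult.assoc)
  qed auto
  also have "\<dots> \<le> 2 * ?I * (\<integral>\<^sup>+k. ?a k * ennreal (\<bar>of_int k\<bar> powr (4 + p - 1)) \<partial>count_space UNIV)"
    by (rule nn_integral_Fourier_weight[where \<phi> = ?\<phi>]) (auto simp: power2_commute)
  also have "(\<integral>\<^sup>+k. ?a k * ennreal (\<bar>of_int k\<bar> powr (4 + p - 1)) \<partial>count_space UNIV) =
     ennreal (2 * pi) * (\<integral>\<^sup>+k. ennreal (\<bar>real_of_int k\<bar> powr (2 * ((3 + p) / 2)) * (norm (fourier_coeff \<gamma> k))\<^sup>2) \<partial>count_space UNIV)"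
  proof -
    have *: "4 + p - 1 = 2 * ((3 + p) / 2)" by (simp add: field_simps)
    have "?a k * ennreal (\<bar>of_int k\<bar> powr (4 + p - 1)) =
       ennreal (2 * pi) * ennreal (\<bar>real_of_int k\<bar> powr (2 * ((3 + p) / 2)) * (norm (fourier_coeff \<gamma> k))\<^sup>2)" for k
      unfolding * by (simp only: mult.assoc ennreal_mult''[symmetric] powr_ge_zero)
        (simp only: mult.commute)
    then show ?thesis
      by (simp only:) (rule nn_integral_cmult, simp)
  qed
  also have "2 * ?I * \<dots> \<le> 2 * ?I * (ennreal (2 * pi) * ?H)"
    unfolding Hdot_norm_sq_def by (intro mult_left_mono nn_integral_count_space_le_infsum) auto
  also have "\<dots> = ennreal (4 * pi) * ?I * ?H"
  proof -
    have "ennreal (4 * pi) = 2 * ennreal (2 * pi)"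
      using ennreal_mult[of 2 "2 * pi"] by simp
    then show ?thesis by (simp only: mult_ac)
  qed
  finally show ?thesis .
qed

end

section \<open>Triple product, arc length and distortion\<close>

lemma norm_cross3_le: "norm (cross3 x y) \<le> norm x * norm y"
proof (rule power2_le_imp_le)
  show "(norm (cross3 x y))\<^sup>2 \<le> (norm x * norm y)\<^sup>2"
    using norm_cross_dot[of x y] zero_le_power2[of "x \<bullet> y"] by linarith
qed simp

lemma triple_le: "\<bar>triple a b c\<bar> \<le> norm a * (norm (b - a) * norm (c - z *\<^sub>R a))"
proof -
  have "triple a b c = a \<bullet> cross3 (b - a) (c - z *\<^sub>R a)"
    by (simp add: triple_def cross3_simps)
  also have "\<bar>\<dots>\<bar> \<le> norm a * norm (cross3 (b - a) (c - z *\<^sub>R a))"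
    by (rule Cauchy_Schwarz_ineq2)
  also have "\<dots> \<le> norm a * (norm (b - a) * norm (c - z *\<^sub>R a))"
    by (intro mult_left_mono norm_cross3_le) auto
  finally show ?thesis .
qed

lemma arc_length_constant_speed:
  assumes "constant_speed \<gamma>" "a \<le> b"
  shows "(LINT t:{a..b}|lebesgue. norm (curve_deriv \<gamma> t)) = len \<gamma> / (2 * pi) * (b - a)"
proof -
  have ae: "AE t in lebesgue. len \<gamma> / (2 * pi) = norm (curve_deriv \<gamma> t)"
    using assms(1) unfolding constant_speed_def by eventually_elim simp
  have m: "(\<lambda>t. norm (curve_deriv \<gamma> t)) \<in> borel_measurable lebesgue"
    by (rule borel_measurable_AE[OF _ ae]) simp
  have "(LINT t:{a..b}|lebesgue. norm (curve_deriv \<gamma> t)) = (\<integral>t. indicator {a..b} t *\<^sub>R (len \<gamma> / (2 * pi)) \<partial>lebesgue)"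
    unfolding set_lebesgue_integral_def
  proof (rule integral_cong_AE)
    show "AE t in lebesgue. indicator {a..b} t *\<^sub>R norm (curve_deriv \<gamma> t) = indicator {a..b} t *\<^sub>R (len \<gamma> / (2 * pi))"
      using ae by eventually_elim simp
  qed (intro borel_measurable_scaleR borel_measurable_indicator m borel_measurable_const; simp)+
  then show ?thesis using assms(2) by simp
qed

lemma arc_dist_constant_speed:
  assumes "constant_speed \<gamma>"
  shows "arc_dist \<gamma> x y = (let l = len \<gamma> * frac ((y - x) / (2 * pi)) in min l (len \<gamma> - l))"
proof -
  have "0 \<le> frac ((y - x) / (2 * pi))" by (rule frac_ge_0)
  then have "(LINT t:{x..x + 2 * pi * frac ((y - x) / (2 * pi))}|lebesgue. norm (curve_deriv \<gamma> t))
       = len \<gamma> * frac ((y - x) / (2 * pi))"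
    by (subst arc_length_constant_speed[OF assms]) auto
  then show ?thesis by (simp add: arc_dist_def)
qed

text \<open>
  For \<open>z < 0\<close> the positively directed arc has parameter length \<open>z + 2\<pi>\<close>, so the complementary arc is
  the shorter one.
\<close>
lemma arc_dist_increment:
  assumes "constant_speed \<gamma>" "0 \<le> len \<gamma>" "\<bar>z\<bar> \<le> pi"
  shows "arc_dist \<gamma> x (x + z) = len \<gamma> / (2 * pi) * \<bar>z\<bar>"
proof (cases "0 \<le> z")
  case True
  moreover from this have "z < 2 * pi" using assms(3) pi_gt_zero by linarith
  ultimately have f: "frac (z / (2 * pi)) = z / (2 * pi)"
    by (simp add: frac_eq)
  have "len \<gamma> * (z / (2 * pi)) \<le> len \<gamma> * (1 / 2)"
    using True assms by (intro mult_left_mono) (auto simp: divide_le_eq)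
  then have "min (len \<gamma> * (z / (2 * pi))) (len \<gamma> - len \<gamma> * (z / (2 * pi))) = len \<gamma> * (z / (2 * pi))"
    by (intro min_absorb1) linarith
  then show ?thesis
    using True by (simp add: arc_dist_constant_speed[OF assms(1)] Let_def f)
next
  case False
  have f: "frac (z / (2 * pi)) = z / (2 * pi) + 1"
    using assms(3) False by (intro frac_unique_iff[THEN iffD2]) (auto simp: field_simps)
  have "len \<gamma> * (- z / (2 * pi)) \<le> len \<gamma> * (1 / 2)"
    using False assms by (intro mult_left_mono) (auto simp: field_simps)
  then have "min (len \<gamma> * (z / (2 * pi) + 1)) (len \<gamma> - len \<gamma> * (z / (2 * pi) + 1)) = len \<gamma> * (- z / (2 * pi))"
    by (subst min_absorb2) (auto simp: algebra_simps)
  then show ?thesis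
    using False by (simp add: arc_dist_constant_speed[OF assms(1)] Let_def f)
qed

lemma periodic_int_multiple:
  fixes \<gamma> :: "real \<Rightarrow> 'a"
  assumes "\<And>x. \<gamma> (x + 2 * pi) = \<gamma> x"
  shows "\<gamma> (x + 2 * pi * of_int n) = \<gamma> x"
proof -
  interpret periodic_fun_simple \<gamma> "2 * pi"
    by standard (rule assms)
  show ?thesis using plus_of_int[of x n] by (simp add: mult.commute)
qed

text \<open>
  The supremum defining the distortion ranges over parameters in \<open>[-\<pi>, \<pi>)\<close>; arbitrary parameters
  are moved there by the map \<open>r\<close>, which changes neither the points nor their arc-length distance.
\<close>
lemma arc_chord_ratio_le_distortion:
  assumes speed: "constant_speed \<gamma>" and per: "\<And>x. \<gamma> (x + 2 * pi) = \<gamma> x"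
    and ne: "\<And>n::int. y - x \<noteq> 2 * pi * of_int n"
  shows "ennreal (arc_dist \<gamma> x y) / ennreal (norm (\<gamma> x - \<gamma> y)) \<le> distortion \<gamma>"
proof -
  define r where "r = (\<lambda>x. x + 2 * pi * of_int (- \<lfloor>(x + pi) / (2 * pi)\<rfloor>))"
  have r: "r x \<in> {-pi..<pi}" for x
  proof -
    have "of_int \<lfloor>(x + pi) / (2 * pi)\<rfloor> * (2 * pi) \<le> x + pi"
      by (subst pos_le_divide_eq[symmetric]) auto
    moreover have "x + pi < (of_int \<lfloor>(x + pi) / (2 * pi)\<rfloor> + 1) * (2 * pi)"
      by (subst pos_divide_less_eq[symmetric]) auto
    ultimately show ?thesis by (simp add: r_def algebra_simps)
  qed
  have g: "\<gamma> (r x) = \<gamma> x" for x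
    unfolding r_def by (rule periodic_int_multiple[of \<gamma>, OF per])
  obtain n :: int where n: "r y - r x = y - x + 2 * pi * of_int n"
  proof
    show "r y - r x = y - x + 2 * pi * of_int (\<lfloor>(x + pi) / (2 * pi)\<rfloor> - \<lfloor>(y + pi) / (2 * pi)\<rfloor>)"
      by (simp add: r_def algebra_simps)
  qed
  have "(r y - r x) / (2 * pi) = (y - x) / (2 * pi) + of_int n"
    unfolding n by (simp add: add_divide_distrib)
  then have "arc_dist \<gamma> (r x) (r y) = arc_dist \<gamma> x y"
    by (simp add: arc_dist_constant_speed[OF speed] frac_def)
  moreover have "r x \<noteq> r y"
    using n ne[of "-n"] by auto
  ultimately show ?thesis
    unfolding distortion_def using r g by (intro SUP_upper2[of "(r x, r y)"]) auto
qed

text \<open>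
  A self-intersection would make one of the ratios, and with it the distortion, infinite.
\<close>
lemma arc_le_distortion_chord:
  assumes speed: "constant_speed \<gamma>" and per: "\<And>x. \<gamma> (x + 2 * pi) = \<gamma> x"
    and len: "0 < len \<gamma>" and D: "distortion \<gamma> = ennreal D" "0 \<le> D" and z: "z \<noteq> 0" "\<bar>z\<bar> \<le> pi"
  shows "len \<gamma> / (2 * pi) * \<bar>z\<bar> \<le> D * norm (\<gamma> (x + z) - \<gamma> x)" "0 < norm (\<gamma> (x + z) - \<gamma> x)"
proof -
  let ?a = "len \<gamma> / (2 * pi) * \<bar>z\<bar>" and ?n = "norm (\<gamma> (x + z) - \<gamma> x)"
  have a: "0 < ?a" using len z by simp
  have "x + z - x \<noteq> 2 * pi * of_int n" for n :: int
  proof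
    assume *: "x + z - x = 2 * pi * of_int n"
    then have "2 * pi * \<bar>of_int n\<bar> \<le> pi" using z(2) by (simp add: abs_mult)
    then have "\<bar>real_of_int n\<bar> < 1" by simp
    then have "n = 0" by linarith
    with * z(1) show False by simp
  qed
  then have le: "ennreal ?a / ennreal ?n \<le> ennreal D"
    using arc_chord_ratio_le_distortion[OF speed per, of "x + z" x] len z D
    by (simp add: arc_dist_increment[OF speed] norm_minus_commute)
  show n: "0 < ?n"
  proof (rule ccontr)
    assume "\<not> 0 < ?n"
    then have "ennreal ?a / ennreal ?n = top"
      using a len z by (simp add: ennreal_divide_eq_top_iff)
    with le show False by (simp add: top_unique)
  qed
  with le a D have "?a / ?n \<le> D"
    by (simp add: divide_ennreal)
  with n show "?a \<le> D * ?n" by (simp add: field_simps)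
qed

text \<open>
  Three powers of the chord \<open>n\<close> become three powers of \<open>D / (v |z|)\<close>.  One of the resulting factors
  \<open>1/v\<close> cancels against \<open>t\<close>, and the exponent \<open>-p - 3\<close> of \<open>|z|\<close> is distributed as
  \<open>-(2+p)/2 - (4+p)/2\<close>.
\<close>
lemma weighted_integrand_le:
  fixes v z n D t a b p :: real
  assumes "0 < v" "z \<noteq> 0" "0 < n" "v * \<bar>z\<bar> \<le> D * n" "t \<le> v * (a * b)" "0 \<le> a" "0 \<le> b"
  shows "(2 * pi * v / (v * \<bar>z\<bar>)) powr p * (t / n ^ 3) \<le>
    ((2 * pi) powr p * D ^ 3 / v\<^sup>2) * ((a * \<bar>z\<bar> powr (- (2 + p) / 2)) * (b * \<bar>z\<bar> powr (- (4 + p) / 2)))"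
proof -
  define w where "w = v * \<bar>z\<bar>"
  have w: "0 < w" using assms by (simp add: w_def)
  have "w ^ 3 \<le> (D * n) ^ 3" using assms w unfolding w_def by (intro power_mono) auto
  then have "1 / n ^ 3 \<le> D ^ 3 / w ^ 3"
    using assms(3) zero_less_power[OF w, of 3]
    by (simp add: pos_le_divide_eq pos_divide_le_eq power_mult_distrib)
  then have "t / n ^ 3 \<le> (v * (a * b)) * (D ^ 3 / w ^ 3)"
    using mult_mono[OF assms(5), of "1 / n ^ 3" "D ^ 3 / w ^ 3"] assms by simp
  also have "\<dots> = (D ^ 3 / v\<^sup>2) * (a * b) / \<bar>z\<bar> ^ 3"
    using assms by (simp add: w_def field_simps power2_eq_square power3_eq_cube)
  also have "\<dots> = (D ^ 3 / v\<^sup>2) * (a * b) * \<bar>z\<bar> powr (-3)"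
    using assms by (simp add: powr_minus powr_numeral divide_inverse)
  finally have *: "t / n ^ 3 \<le> (D ^ 3 / v\<^sup>2) * (a * b) * \<bar>z\<bar> powr (-3)" .
  have "2 * pi * v / w = 2 * pi * \<bar>z\<bar> powr (-1)"
    using assms by (simp add: w_def powr_minus divide_inverse)
  then have "(2 * pi * v / w) powr p = (2 * pi * \<bar>z\<bar> powr (-1)) powr p"
    by (simp only:)
  also have "\<dots> = (2 * pi) powr p * \<bar>z\<bar> powr (-p)"
    by (simp only: powr_mult powr_powr mult_minus1)
  finally have "(2 * pi * v / w) powr p = (2 * pi) powr p * \<bar>z\<bar> powr (-p)" .
  then have "(2 * pi * v / w) powr p * (t / n ^ 3) \<le>
      (2 * pi) powr p * \<bar>z\<bar> powr (-p) * ((D ^ 3 / v\<^sup>2) * (a * b) * \<bar>z\<bar> powr (-3))"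
    by (simp only:) (rule mult_left_mono[OF *], simp)
  also have "\<dots> = ((2 * pi) powr p * D ^ 3 / v\<^sup>2) * (a * b) * (\<bar>z\<bar> powr (-p) * \<bar>z\<bar> powr (-3))"
    by simp
  also have "\<bar>z\<bar> powr (-p) * \<bar>z\<bar> powr (-3) = \<bar>z\<bar> powr (- (2 + p) / 2) * \<bar>z\<bar> powr (- (4 + p) / 2)"
  proof -
    have "-p + -3 = - (2 + p) / 2 + - (4 + p) / 2" by (simp add: field_simps)
    then show ?thesis by (simp only: powr_add[symmetric])
  qed
  finally show ?thesis by (simp add: w_def mult_ac)
qed

section \<open>The estimate for the weighted quantity\<close>

lemma ennreal_sqrt_power2: "(ennreal_sqrt x)\<^sup>2 = x"
proof (cases x)
  case (real r)
  then show ?thesis by (simp add: ennreal_sqrt_def ennreal_power)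
qed (simp add: ennreal_sqrt_def)

lemma ennreal_power2_le_imp_le:
  fixes x y :: ennreal
  assumes "x\<^sup>2 \<le> y\<^sup>2"
  shows "x \<le> y"
proof (cases y)
  case (real s)
  with assms have "x \<noteq> top" by (auto simp: ennreal_power top_unique)
  then obtain r where "x = ennreal r" "0 \<le> r" by (cases x) auto
  with real assms show ?thesis
    by (auto simp: ennreal_power intro!: ennreal_leI power2_le_imp_le)
qed simp

lemma C_const_finite:
  assumes "-1 < p" "p < 1"
  shows "C_const p < \<infinity>"
proof -
  have sqrt: "ennreal_sqrt x < top" if "x < \<infinity>" for x
    using that by (simp add: ennreal_sqrt_def)
  show ?thesis
    unfolding C_const_def nn_integral_completion infinity_ennreal_def
    by (intro ennreal_mult_less_top[THEN iffD2] disjI2 conjI sqrt ennreal_less_top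
        nn_integral_velocity_symbol_finite nn_integral_Taylor_symbol_finite assms)
qed

text \<open>
  The constant arises as \<open>8\<pi> \<cdot> 4\<pi> = (2 \<surd>2 \<cdot> 2\<pi>)\<^sup>2\<close>.  Comparing squares avoids multiplying square roots of
  possibly infinite quantities.
\<close>
lemma Cauchy_Schwarz_weighted_energies:
  fixes \<gamma> d :: "real \<Rightarrow> real ^ 3" and p K :: real
  assumes lip: "K-lipschitz_on UNIV \<gamma>" and per: "\<And>x. \<gamma> (x + 2 * pi) = \<gamma> x"
    and d [measurable]: "d \<in> borel_measurable borel"
    and lim: "AE x in lborel. (\<lambda>n. diff_quot n \<gamma> x) \<longlonglongrightarrow> d x"
  shows "(\<integral>\<^sup>+y\<in>{-pi..pi} \<times> {-pi..pi}. (case y of (x, z) \<Rightarrow>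
        ennreal ((norm (d (x + z) - d x) * \<bar>z\<bar> powr (- (2 + p) / 2)) *
                 (norm (\<gamma> (x + z) - \<gamma> x - z *\<^sub>R d x) * \<bar>z\<bar> powr (- (4 + p) / 2)))) \<partial>(lborel \<Otimes>\<^sub>M lborel))
    \<le> ennreal (2 * sqrt 2 * (2 * pi)) *
      ennreal_sqrt (\<integral>\<^sup>+u\<in>{0<..}. ennreal ((1 - cos u) / u powr (2 + p)) \<partial>lborel) *
      ennreal_sqrt (\<integral>\<^sup>+u\<in>{0<..}. ennreal (((1 - cos u)\<^sup>2 + (sin u - u)\<^sup>2) / u powr (4 + p)) \<partial>lborel) *
      Hdot_norm_sq ((3 + p) / 2) \<gamma>"
    (is "?T \<le> _ * ennreal_sqrt ?I * ennreal_sqrt ?J * ?H")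
proof (rule ennreal_power2_le_imp_le)
  have g [measurable]: "\<gamma> \<in> borel_measurable borel"
    using lip by (intro borel_measurable_continuous_onI lipschitz_on_continuous_on)
  let ?i = "indicator {-pi..pi} :: real \<Rightarrow> ennreal"
  \<comment> \<open>Both factors carry the indicator of the square, so that each energy is again an integral over it.\<close>
  define F where "F = (\<lambda>(x, z). ennreal (norm (d (x + z) - d x) * \<bar>z\<bar> powr (- (2 + p) / 2)) * (?i x * ?i z))"
  define G where "G = (\<lambda>(x, z). ennreal (norm (\<gamma> (x + z) - \<gamma> x - z *\<^sub>R d x) * \<bar>z\<bar> powr (- (4 + p) / 2)) * (?i x * ?i z))"
  have [measurable]: "F \<in> borel_measurable (lborel \<Otimes>\<^sub>M lborel)" "G \<in> borel_measurable (lborel \<Otimes>\<^sub>M lborel)"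
    unfolding F_def G_def by measurable
  have slice: "(\<integral>\<^sup>+x. (ennreal (h x * \<bar>z\<bar> powr (- q / 2)) * (?i x * ?i z))\<^sup>2 \<partial>lborel) =
      ennreal (\<bar>z\<bar> powr (- q)) * (\<integral>\<^sup>+x. ennreal ((h x)\<^sup>2) \<partial>circle) * ?i z"
    if [measurable]: "h \<in> borel_measurable borel" and h: "\<And>x. 0 \<le> h x" for h z q
  proof -
    have "(ennreal (h x * \<bar>z\<bar> powr (- q / 2)) * (?i x * ?i z))\<^sup>2 =
        (ennreal (\<bar>z\<bar> powr (- q)) * ?i z) * (ennreal ((h x)\<^sup>2) * ?i x)" for x
    proof -
      have "(\<bar>z\<bar> powr (- q / 2))\<^sup>2 = \<bar>z\<bar> powr (- q)"
        by (simp add: power2_eq_square powr_add[symmetric])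
      then have "(ennreal (h x * \<bar>z\<bar> powr (- q / 2)))\<^sup>2 = ennreal (\<bar>z\<bar> powr (- q)) * ennreal ((h x)\<^sup>2)"
        by (simp add: ennreal_power h power_mult_distrib ennreal_mult[symmetric] mult.commute)
      then show ?thesis
        by (auto simp: power_mult_distrib split: split_indicator)
    qed
    then have "(\<integral>\<^sup>+x. (ennreal (h x * \<bar>z\<bar> powr (- q / 2)) * (?i x * ?i z))\<^sup>2 \<partial>lborel) =
        (ennreal (\<bar>z\<bar> powr (- q)) * ?i z) * (\<integral>\<^sup>+x. ennreal ((h x)\<^sup>2) * ?i x \<partial>lborel)"
      by (simp only:) (rule nn_integral_cmult, measurable)
    then show ?thesis
      by (simp only: nn_integral_circle mult_ac)
  qed
  have "?T = (\<integral>\<^sup>+y. F y * G y \<partial>(lborel \<Otimes>\<^sub>M lborel))"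
    by (intro nn_integral_cong)
       (auto simp: F_def G_def ennreal_mult indicator_def)
  then have "?T\<^sup>2 \<le> (\<integral>\<^sup>+y. (F y)\<^sup>2 \<partial>(lborel \<Otimes>\<^sub>M lborel)) * (\<integral>\<^sup>+y. (G y)\<^sup>2 \<partial>(lborel \<Otimes>\<^sub>M lborel))"
    by (simp only:) (rule Cauchy_Schwarz_nn_integral; measurable)
  also have "(\<integral>\<^sup>+y. (F y)\<^sup>2 \<partial>(lborel \<Otimes>\<^sub>M lborel)) = (\<integral>\<^sup>+z. \<integral>\<^sup>+x. (F (x, z))\<^sup>2 \<partial>lborel \<partial>lborel)"
    by (rule lborel_pair.nn_integral_snd[symmetric]) measurable
  also have "\<dots> \<le> ennreal (8 * pi) * ?I * ?H"
    unfolding F_def prod.case using weighted_velocity_energy_le[OF lip per d lim, of p]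
    by (subst slice) auto
  also have "(\<integral>\<^sup>+y. (G y)\<^sup>2 \<partial>(lborel \<Otimes>\<^sub>M lborel)) = (\<integral>\<^sup>+z. \<integral>\<^sup>+x. (G (x, z))\<^sup>2 \<partial>lborel \<partial>lborel)"
    by (rule lborel_pair.nn_integral_snd[symmetric]) measurable
  also have "\<dots> \<le> ennreal (4 * pi) * ?J * ?H"
    unfolding G_def prod.case using weighted_Taylor_energy_le[OF lip per d lim, of p]
    by (subst slice) auto
  finally have "?T\<^sup>2 \<le> (ennreal (8 * pi) * ?I * ?H) * (ennreal (4 * pi) * ?J * ?H)"
    by (simp add: mult_left_mono mult_right_mono)
  also have "\<dots> = (ennreal (8 * pi) * ennreal (4 * pi)) * ?I * ?J * ?H\<^sup>2"
    by (simp only: power2_eq_square mult_ac)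
  also have "ennreal (8 * pi) * ennreal (4 * pi) = (ennreal (2 * sqrt 2 * (2 * pi)))\<^sup>2"
    by (simp add: ennreal_power ennreal_mult[symmetric] power_mult_distrib power2_eq_square)
  also have "\<dots> * ?I * ?J * ?H\<^sup>2 =
      (ennreal (2 * sqrt 2 * (2 * pi)) * ennreal_sqrt ?I * ennreal_sqrt ?J * ?H)\<^sup>2"
    by (simp only: power_mult_distrib ennreal_sqrt_power2)
  finally show "?T\<^sup>2 \<le> (ennreal (2 * sqrt 2 * (2 * pi)) * ennreal_sqrt ?I * ennreal_sqrt ?J * ?H)\<^sup>2" .
qed

text \<open>
  The pairs \<open>(x, z)\<close> for which \<open>x\<close> or \<open>x + z\<close> lies in a given null set form a null set, since almost
  every vertical slice of it is a translate of that null set.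
\<close>
lemma AE_lborel_pair_shift:
  fixes P :: "real \<Rightarrow> bool"
  assumes "AE x in lborel. P x"
  shows "AE y in lborel \<Otimes>\<^sub>M lborel. P (fst y) \<and> P (fst y + snd y)"
proof -
  obtain N where N: "\<And>x. x \<in> space lborel - N \<Longrightarrow> P x" "N \<in> null_sets lborel"
    using assms by (rule AE_E3) blast
  then have [measurable]: "N \<in> sets borel" by auto
  have out: "AE x in lborel. x \<notin> N"
    using N(2) by (rule AE_not_in)
  have "AE y in lborel \<Otimes>\<^sub>M lborel. fst y \<notin> N \<and> fst y + snd y \<notin> N"
  proof (rule lborel_pair.AE_pair_measure)
    show "{y \<in> space (lborel \<Otimes>\<^sub>M lborel). fst y \<notin> N \<and> fst y + snd y \<notin> N} \<in> sets (lborel \<Otimes>\<^sub>M lborel)"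
      by measurable
    show "AE x in lborel. AE z in lborel. fst (x, z) \<notin> N \<and> fst (x, z) + snd (x, z) \<notin> N"
      using out
    proof eventually_elim
      case (elim x)
      then show ?case using AE_lborel_shift[OF out, of x] by (simp add: add.commute)
    qed
  qed
  then show ?thesis
    by eventually_elim (auto intro: N(1))
qed

theorem lemma3p3:
  fixes \<gamma> :: "real \<Rightarrow> real ^ 3" and p :: real
  assumes "closed_lipschitz_curve \<gamma>"
    and "distortion \<gamma> < \<infinity>"
    and "constant_speed \<gamma>"
  shows "weighted_acn p \<gamma> \<le>
           C_const p * ennreal ((2 * pi / len \<gamma>)\<^sup>2) * Hdot_norm_sq ((3 + p) / 2) \<gamma> * distortion \<gamma> ^ 3
         \<and> (-1 < p \<and> p < 1 \<longrightarrow> C_const p < \<infinity>)"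
proof (intro conjI impI)
  show "C_const p < \<infinity>" if "-1 < p \<and> p < 1"
    using that by (intro C_const_finite) auto
  obtain K where lip: "K-lipschitz_on UNIV \<gamma>" and per: "\<And>x. \<gamma> (x + 2 * pi) = \<gamma> x"
    using assms(1) by (auto simp: closed_lipschitz_curve_def)
  have "0 \<le> len \<gamma>"
    unfolding len_def set_lebesgue_integral_def by (intro integral_nonneg_AE) simp
  show "weighted_acn p \<gamma> \<le>
      C_const p * ennreal ((2 * pi / len \<gamma>)\<^sup>2) * Hdot_norm_sq ((3 + p) / 2) \<gamma> * distortion \<gamma> ^ 3"
  proof (cases "len \<gamma> = 0")
    case True
    \<comment> \<open>A constant curve: the weight is \<open>0 powr p = 0\<close>.\<close>
    then have "weighted_acn p \<gamma> = 0" by (simp add: weighted_acn_def)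
    then show ?thesis by simp
  next
    case False
    with \<open>0 \<le> len \<gamma>\<close> have len: "0 < len \<gamma>" by simp
    define v where "v = len \<gamma> / (2 * pi)"
    have v: "0 < v" "len \<gamma> = 2 * pi * v" using len by (auto simp: v_def)
    obtain D where D: "distortion \<gamma> = ennreal D" "0 \<le> D"
      using assms(2) by (cases "distortion \<gamma>") auto
    have g [measurable]: "\<gamma> \<in> borel_measurable borel"
      using lip by (intro borel_measurable_continuous_onI lipschitz_on_continuous_on)
    define d where "d = (\<lambda>x. lim (\<lambda>n. diff_quot n \<gamma> x))"
    have d [measurable]: "d \<in> borel_measurable borel"
      unfolding d_def diff_quot_def by measurable
    have good: "AE x in lborel. (\<lambda>n. diff_quot n \<gamma> x) \<longlonglongrightarrow> d x \<and> curve_deriv \<gamma> x = d x \<and> norm (d x) = v"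
      using assms(3) unfolding constant_speed_def AE_completion_iff
    proof eventually_elim
      case (elim x)
      then have "(\<lambda>n. diff_quot n \<gamma> x) \<longlonglongrightarrow> curve_deriv \<gamma> x"
        by (intro diff_quot_tendsto) (simp add: vector_derivative_works)
      moreover from this have "d x = curve_deriv \<gamma> x"
        unfolding d_def by (rule limI)
      ultimately show ?case using elim by (simp add: v_def)
    qed
    let ?k = "(2 * pi) powr p * D ^ 3 / v\<^sup>2"
    let ?E = "\<lambda>x z. (norm (d (x + z) - d x) * \<bar>z\<bar> powr (- (2 + p) / 2)) *
                 (norm (\<gamma> (x + z) - \<gamma> x - z *\<^sub>R d x) * \<bar>z\<bar> powr (- (4 + p) / 2))"
    let ?S = "{-pi..pi} \<times> {-pi..pi} :: (real \<times> real) set"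
    have "weighted_acn p \<gamma> = (\<integral>\<^sup>+y\<in>?S. (case y of (x, z) \<Rightarrow>
        ennreal ((len \<gamma> / arc_dist \<gamma> x (x + z)) powr p *
          (\<bar>triple (curve_deriv \<gamma> x) (curve_deriv \<gamma> (x + z)) (\<gamma> (x + z) - \<gamma> x)\<bar> /
           norm (\<gamma> (x + z) - \<gamma> x) ^ 3))) \<partial>(lborel \<Otimes>\<^sub>M lborel))"
      unfolding weighted_acn_def nn_integral_completion lborel_prod
      by (intro nn_integral_cong) (auto split: prod.split)
    also have "\<dots> \<le> (\<integral>\<^sup>+y. ennreal ?k * ((case y of (x, z) \<Rightarrow> ennreal (?E x z)) * indicator ?S y) \<partial>(lborel \<Otimes>\<^sub>M lborel))"
    proof (rule nn_integral_mono_AE, use AE_lborel_pair_shift[OF good] in eventually_elim)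
      case (elim y)
      obtain x z where y: "y = (x, z)" by fastforce
      show ?case
      proof (cases "z \<noteq> 0 \<and> \<bar>z\<bar> \<le> pi")
        case True
        then have z: "z \<noteq> 0" "\<bar>z\<bar> \<le> pi" by auto
        note chord = arc_le_distortion_chord[OF assms(3) per len D z, of x]
        have "(len \<gamma> / arc_dist \<gamma> x (x + z)) powr p *
            (\<bar>triple (curve_deriv \<gamma> x) (curve_deriv \<gamma> (x + z)) (\<gamma> (x + z) - \<gamma> x)\<bar> /
             norm (\<gamma> (x + z) - \<gamma> x) ^ 3) \<le> ?k * ?E x z"
        proof -
          have "arc_dist \<gamma> x (x + z) = v * \<bar>z\<bar>"
            using z len by (simp add: arc_dist_increment[OF assms(3)] v_def)
          moreover have "\<bar>triple (d x) (d (x + z)) (\<gamma> (x + z) - \<gamma> x)\<bar> \<le>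
              v * (norm (d (x + z) - d x) * norm (\<gamma> (x + z) - \<gamma> x - z *\<^sub>R d x))"
            using triple_le[of "d x" "d (x + z)" "\<gamma> (x + z) - \<gamma> x" z] elim by (simp add: y)
          then have "(2 * pi * v / (v * \<bar>z\<bar>)) powr p *
             (\<bar>triple (d x) (d (x + z)) (\<gamma> (x + z) - \<gamma> x)\<bar> / norm (\<gamma> (x + z) - \<gamma> x) ^ 3) \<le> ?k * ?E x z"
            by (intro weighted_integrand_le[OF v(1) z(1) chord(2) chord(1)[folded v_def]]) auto
          ultimately show ?thesis using elim v(2) by (simp add: y)
        qed
        moreover have "0 \<le> ?E x z" "0 \<le> ?k" using D(2) by auto
        ultimately show ?thesis
          by (auto simp: y ennreal_mult[symmetric] intro!: ennreal_leI split: split_indicator)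
      next
        case False
        \<comment> \<open>On the diagonal \<open>z = 0\<close> the chord vanishes, and with it the triple product.\<close>
        then consider "z = 0" | "\<not> \<bar>z\<bar> \<le> pi" by blast
        then show ?thesis
        proof cases
          case 1
          have "triple a b 0 = 0" for a b by (simp add: triple_def)
          with 1 show ?thesis
            by (simp only: y prod.case add_0_right diff_self abs_zero div_0 mult_zero_right
                mult_zero_left ennreal_0 zero_le)
        next
          case 2
          then have "y \<notin> ?S" by (auto simp: y)
          then show ?thesis by simp
        qed
      qed
    qed
    also have "\<dots> = ennreal ?k * (\<integral>\<^sup>+y\<in>?S. (case y of (x, z) \<Rightarrow> ennreal (?E x z)) \<partial>(lborel \<Otimes>\<^sub>M lborel))"
      by (rule nn_integral_cmult) measurable
    also have "\<dots> \<le> ennreal ?k * (ennreal (2 * sqrt 2 * (2 * pi)) *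
      ennreal_sqrt (\<integral>\<^sup>+u\<in>{0<..}. ennreal ((1 - cos u) / u powr (2 + p)) \<partial>lborel) *
      ennreal_sqrt (\<integral>\<^sup>+u\<in>{0<..}. ennreal (((1 - cos u)\<^sup>2 + (sin u - u)\<^sup>2) / u powr (4 + p)) \<partial>lborel) *
      Hdot_norm_sq ((3 + p) / 2) \<gamma>)"
    proof (intro mult_left_mono Cauchy_Schwarz_weighted_energies[OF lip per d])
      show "AE x in lborel. (\<lambda>n. diff_quot n \<gamma> x) \<longlonglongrightarrow> d x"
        using good by eventually_elim simp
    qed simp
    also have "\<dots> = C_const p * ennreal ((2 * pi / len \<gamma>)\<^sup>2) * Hdot_norm_sq ((3 + p) / 2) \<gamma> * distortion \<gamma> ^ 3"
    proof -
      let ?c = "2 * sqrt 2 * (2 * pi)" and ?c' = "2 * sqrt 2 * (2 * pi) powr (p + 1)"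
        and ?l = "(2 * pi / len \<gamma>)\<^sup>2"
      have "?k * ?c = ?c' * ?l * D ^ 3"
      proof -
        have l: "2 * pi / len \<gamma> = 1 / v" using len by (simp add: v_def)
        have e: "(2 * pi) powr (p + 1) = (2 * pi) powr p * (2 * pi)" by (simp add: powr_add)
        have "?k = (2 * pi) powr p * D ^ 3 * (1 / v)\<^sup>2"
          by (simp only: divide_inverse mult_1_left power_inverse)
        then show ?thesis unfolding l e by (simp only: mult_ac)
      qed
      moreover have "ennreal ?k * ennreal ?c = ennreal (?k * ?c)"
        using D(2) by (intro ennreal_mult[symmetric]) auto
      moreover have "ennreal (?c' * ?l * D ^ 3) = ennreal ?c' * ennreal ?l * distortion \<gamma> ^ 3"
        using ennreal_mult[of "?c' * ?l" "D ^ 3"] ennreal_mult[of ?c' ?l] ennreal_power[OF D(2), of 3] D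
        by (simp only: D(1)) simp
      ultimately have *: "ennreal ?k * ennreal ?c = ennreal ?c' * ennreal ?l * distortion \<gamma> ^ 3"
        by (simp only:)
      have regroup: "k * (c * s * t * h) = (c' * s * t) * l * h * D" if "k * c = c' * l * D" for k c s t h c' l D :: ennreal
      proof -
        have "k * (c * s * t * h) = (k * c) * (s * t * h)" by (simp only: mult.assoc)
        also have "\<dots> = (c' * s * t) * l * h * D" unfolding that by (simp only: mult_ac)
        finally show ?thesis .
      qed
      show ?thesis
        unfolding C_const_def nn_integral_completion by (rule regroup[OF *])
    qed
    finally show ?thesis .
  qed
qed

end
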